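(* Let $(\kappa,\mathbf{u})$ and $(\kappa_h,\mathbf{u}_h)$ be the eigenpairs of the continuous and of the discrete linear elasticity eigenvalue problem, respectively, with $\kappa>0$, and let $\mathbf{e}=\mathbf{u}-\mathbf{u}_h$. Then the estimator $\mu$ bounds the error from above: $$|||\mathbf{e}|||\le\sqrt{3}\,\mu+\frac{\kappa+\kappa_h}{2\sqrt{\kappa}}\,\|\mathbf{e}\|_0 .$$
   Context: Setting. $\Omega\subset\mathbb{R}^2$ is a Lipschitz domain with polygonal boundary, split into a closed Dirichlet part $\Gamma_D$, a closed gliding part $\Gamma_g$ and the open Neumann part $\Gamma_N=\partial\Omega\setminus(\Gamma_D\cup\Gamma_g)$; each part is connected, they do not overlap in more than a vertex, and up to two of them may be empty. $\mathbf{n}$ is the outer unit normal. $\mathbb{C}$ is the stiffness (elasticity) tensor of linear elasticity (symmetric positive definite on symmetric $2\times2$ matrices, with square root $\mathbb{C}^{1/2}$), $\varepsilon(\mathbf{v})=\frac12(\nabla\mathbf{v}+\nabla\mathbf{v}^T)$. $\|\cdot\|_0$ and $(\cdot,\cdot)_0$ are the $L^2(\Omega)$ norm and inner product. Spaces and eigenproblems. $\mathbf{H}=\{\mathbf{v}\in H^1(\Omega,\mathbb{R}^2): \mathbf{v}=\mathbf{0}\text{ on }\Gamma_D,\ \mathbf{v}\cdot\mathbf{n}=0\text{ on }\Gamma_g\}$; $a(\mathbf{u},\mathbf{v})=\int_\Omega \mathbb{C}\varepsilon(\mathbf{u}):\varepsilon(\mathbf{v})\,dx$; $|||\mathbf{v}|||=a(\mathbf{v},\mathbf{v})^{1/2}=\|\mathbb{C}^{1/2}\varepsilon(\mathbf{v})\|_0$.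 $\mathcal{T}$ is a regular, quasi-uniform triangulation of $\Omega$ (resolving the boundary parts) with vertex set $\mathcal{N}$. $\mathbf{H}_h\subset\mathbf{H}$ consists of the functions in $\mathbf{H}$ whose components are polynomials of total degree at most $k$ ($k\ge1$) on each $T\in\mathcal{T}$. Continuous eigenpair: $\kappa\ge0$, $\mathbf{u}\in\mathbf{H}$, $\|\mathbf{u}\|_0=1$, $a(\mathbf{u},\mathbf{v})=\kappa(\mathbf{u},\mathbf{v})_0$ for all $\mathbf{v}\in\mathbf{H}$. Discrete eigenpair: $\kappa_h\ge0$, $\mathbf{u}_h\in\mathbf{H}_h$, $\|\mathbf{u}_h\|_0=1$, $a(\mathbf{u}_h,\mathbf{v}_h)=\kappa_h(\mathbf{u}_h,\mathbf{v}_h)_0$ for all $\mathbf{v}_h\in\mathbf{H}_h$. Eigenvalues are ordered increasingly, the two eigenpairs have the same index (so $\kappa_h\ge\kappa$), and $\kappa$ is assumed simple. Residual and partition of unity. $Res_h(\mathbf{v})=\kappa_h(\mathbf{u}_h,\mathbf{v})_0-a(\mathbf{u}_h,\mathbf{v})$ for $\mathbf{v}\in\mathbf{H}$. For $z\in\mathcal{N}$, $\varphi_z$ is the continuous piecewise affine hat function with $\varphi_z(z)=1$ and $\varphi_z=0$ at all other vertices; $\omega_z=\{x\in\Omega:\varphi_z(x)\ne0\}$; $\|\cdot\|_z$ is the $L^2(\omega_z)$ norm; $Res_z(\mathbf{v})=Res_h(\varphi_z\mathbf{v})$. Estimator. $\mu_z=\sup\{Res_z(\mathbf{v})/\|\varphi_z^{1/2}\mathbb{C}^{1/2}\varepsilon(\mathbf{v})\|_z:\mathbf{v}\in\mathbf{H},\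 \|\varphi_z^{1/2}\mathbb{C}^{1/2}\varepsilon(\mathbf{v})\|_z\ne0\}$ and $\mu^2=\sum_{z\in\mathcal{N}}\mu_z^2$. *)

theory Defs
  imports "HOL-Analysis.Analysis"
begin

text \<open>
  Elements of \<open>L\<^sup>2\<close> and \<open>H\<^sup>1\<close> are represented by functions on the whole plane; only their values on
  the domain, up to Lebesgue null sets, matter.
\<close>

type_synonym vfield = "real^2 \<Rightarrow> real^2"
type_synonym tensor = "real^2^2 \<Rightarrow> real^2^2"

section \<open>Lebesgue and Sobolev spaces\<close>

definition square_integrable ::
    "'a::euclidean_space set \<Rightarrow> ('a \<Rightarrow> 'b::euclidean_space) \<Rightarrow> bool" where
  "square_integrable S f \<longleftrightarrow>
     f \<in> borel_measurable (lebesgue_on S) \<and> integrable (lebesgue_on S) (\<lambda>x. (norm (f x))\<^sup>2)"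

definition l2_inner ::
    "'a::euclidean_space set \<Rightarrow> ('a \<Rightarrow> 'b::euclidean_space) \<Rightarrow> ('a \<Rightarrow> 'b) \<Rightarrow> real" where
  "l2_inner S f g = (\<integral>x. f x \<bullet> g x \<partial>lebesgue_on S)"

definition l2_norm :: "'a::euclidean_space set \<Rightarrow> ('a \<Rightarrow> 'b::euclidean_space) \<Rightarrow> real" where
  "l2_norm S f = sqrt (\<integral>x. (norm (f x))\<^sup>2 \<partial>lebesgue_on S)"

definition partial :: "2 \<Rightarrow> (real^2 \<Rightarrow> real) \<Rightarrow> real^2 \<Rightarrow> real" where
  "partial j f x = frechet_derivative f (at x) (axis j 1)"

primrec Ck :: "nat \<Rightarrow> (real^2 \<Rightarrow> real) \<Rightarrow> bool" where
  "Ck 0 f \<longleftrightarrow> continuous_on UNIV f"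
| "Ck (Suc k) f \<longleftrightarrow> f differentiable_on UNIV \<and> (\<forall>j. Ck k (partial j f))"

definition test_function :: "(real^2) set \<Rightarrow> (real^2 \<Rightarrow> real) \<Rightarrow> bool" where
  "test_function \<Omega> \<psi> \<longleftrightarrow>
     (\<forall>k. Ck k \<psi>) \<and> (\<exists>K. compact K \<and> K \<subseteq> \<Omega> \<and> (\<forall>x. x \<notin> K \<longrightarrow> \<psi> x = 0))"

text \<open>The entry \<open>G x $ i $ j\<close> is the weak derivative of the \<open>i\<close>-th component in direction \<open>j\<close>.\<close>

definition weak_gradient :: "(real^2) set \<Rightarrow> vfield \<Rightarrow> (real^2 \<Rightarrow> real^2^2) \<Rightarrow> bool" where
  "weak_gradient \<Omega> v G \<longleftrightarrow>
     square_integrable \<Omega> G \<and>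
     (\<forall>\<psi> i j. test_function \<Omega> \<psi> \<longrightarrow>
        (\<integral>x. v x $ i * partial j \<psi> x \<partial>lebesgue_on \<Omega>) = - (\<integral>x. G x $ i $ j * \<psi> x \<partial>lebesgue_on \<Omega>))"

definition H1 :: "(real^2) set \<Rightarrow> vfield set" where
  "H1 \<Omega> = {v. square_integrable \<Omega> v \<and> (\<exists>G. weak_gradient \<Omega> v G)}"

text \<open>The weak gradient is unique up to null sets, so the choice of the representative is immaterial.\<close>

definition grad :: "(real^2) set \<Rightarrow> vfield \<Rightarrow> real^2 \<Rightarrow> real^2^2" where
  "grad \<Omega> v = (SOME G. weak_gradient \<Omega> v G)"

definition strain :: "(real^2) set \<Rightarrow> vfield \<Rightarrow> real^2 \<Rightarrow> real^2^2" where
  "strain \<Omega> v x = (1/2) *\<^sub>R (grad \<Omega> v x + transpose (grad \<Omega> v x))"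

section \<open>Polygonal Lipschitz domains and boundary values\<close>

definition lipschitz_domain :: "(real^2) set \<Rightarrow> bool" where
  "lipschitz_domain \<Omega> \<longleftrightarrow>
     open \<Omega> \<and> connected \<Omega> \<and> bounded \<Omega> \<and> \<Omega> \<noteq> {} \<and>
     (\<forall>p\<in>frontier \<Omega>. \<exists>r>0. \<exists>(R :: real^2 \<Rightarrow> real^2) (g :: real \<Rightarrow> real) L.
        orthogonal_transformation R \<and> L-lipschitz_on UNIV g \<and>
        \<Omega> \<inter> ball p r = {p + R y | y. g (y $ 1) < y $ 2} \<inter> ball p r)"

definition polygonal_boundary :: "(real^2) set \<Rightarrow> bool" where
  "polygonal_boundary \<Omega> \<longleftrightarrow>
     (\<exists>F. finite F \<and> frontier \<Omega> = (\<Union>(a, b)\<in>F. closed_segment a b))"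

text \<open>
  The next definition determines the outer normal at every boundary point near which the boundary is
  straight, that is, at all but finitely many points of a polygonal boundary.
\<close>

definition outer_normal :: "(real^2) set \<Rightarrow> real^2 \<Rightarrow> real^2" where
  "outer_normal \<Omega> x =
     (THE \<nu>. norm \<nu> = 1 \<and> (\<exists>r>0. \<Omega> \<inter> ball x r = {y \<in> ball x r. (y - x) \<bullet> \<nu> < 0}))"

text \<open>
  Arc length on a polygonal boundary is handled through its parametrised segments: a property holds
  almost everywhere on a part \<open>\<Gamma>\<close> of it iff it does so along every nondegenerate segment
  in \<open>\<Gamma>\<close>, and likewise for convergence in \<open>L\<^sup>2\<close> of the boundary. Degenerate segments have
  to be excluded, since on them these conditions would be pointwise ones.
\<close>

definition boundary_AE :: "(real^2) set \<Rightarrow> (real^2 \<Rightarrow> bool) \<Rightarrow> bool" where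
  "boundary_AE \<Gamma> P \<longleftrightarrow>
     (\<forall>a b. a \<noteq> b \<and> closed_segment a b \<subseteq> \<Gamma> \<longrightarrow> (AE t in lebesgue_on {0..1}. P (linepath a b t)))"

text \<open>
  The trace is the bounded extension to \<open>H\<^sup>1\<close> of the restriction to the boundary of functions
  in \<open>H\<^sup>1\<close> that are continuous up to the boundary; \<open>has_trace\<close> is the graph of this extension.
\<close>

definition has_trace :: "(real^2) set \<Rightarrow> vfield \<Rightarrow> vfield \<Rightarrow> bool" where
  "has_trace \<Omega> v g \<longleftrightarrow>
     (\<exists>w :: nat \<Rightarrow> vfield.
        (\<forall>n. w n \<in> H1 \<Omega> \<and> continuous_on (closure \<Omega>) (w n)) \<and>
        (\<lambda>n. l2_norm \<Omega> (\<lambda>x. w n x - v x)) \<longlonglongrightarrow> 0 \<and>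
        (\<lambda>n. l2_norm \<Omega> (\<lambda>x. grad \<Omega> (w n) x - grad \<Omega> v x)) \<longlonglongrightarrow> 0 \<and>
        (\<forall>a b. a \<noteq> b \<and> closed_segment a b \<subseteq> frontier \<Omega> \<longrightarrow>
           square_integrable {0..1} (\<lambda>t. g (linepath a b t)) \<and>
           (\<lambda>n. l2_norm {0..1} (\<lambda>t. w n (linepath a b t) - g (linepath a b t))) \<longlonglongrightarrow> 0))"

definition H_space :: "(real^2) set \<Rightarrow> (real^2) set \<Rightarrow> (real^2) set \<Rightarrow> vfield set" where
  "H_space \<Omega> \<Gamma>D \<Gamma>g =
     {v \<in> H1 \<Omega>. \<exists>g. has_trace \<Omega> v g \<and> boundary_AE \<Gamma>D (\<lambda>x. g x = 0) \<and>
                   boundary_AE \<Gamma>g (\<lambda>x. g x \<bullet> outer_normal \<Omega> x = 0)}"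

section \<open>Triangulations and finite elements\<close>

definition nodes :: "(real^2) set set \<Rightarrow> (real^2) set" where
  "nodes \<T> = {z. \<exists>T\<in>\<T>. z extreme_point_of T}"

text \<open>
  The library notion \<open>triangulation\<close> contains conformity: the intersection of two triangles
  is a common face.
\<close>

definition triangulation_of :: "(real^2) set set \<Rightarrow> (real^2) set \<Rightarrow> bool" where
  "triangulation_of \<T> \<Omega> \<longleftrightarrow>
     triangulation \<T> \<and> (\<forall>T\<in>\<T>. 2 simplex T) \<and> \<Union>\<T> = closure \<Omega>"

definition shape_regular :: "real \<Rightarrow> (real^2) set set \<Rightarrow> bool" where
  "shape_regular c \<T> \<longleftrightarrow> (\<forall>T\<in>\<T>. (diameter T)\<^sup>2 \<le> c * measure lebesgue T)"

definition quasi_uniform :: "real \<Rightarrow> (real^2) set set \<Rightarrow> bool" where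
  "quasi_uniform c \<T> \<longleftrightarrow> (\<forall>T\<in>\<T>. \<forall>T'\<in>\<T>. diameter T \<le> c * diameter T')"

definition resolves_boundary ::
    "(real^2) set set \<Rightarrow> (real^2) set \<Rightarrow> (real^2) set \<Rightarrow> (real^2) set \<Rightarrow> bool" where
  "resolves_boundary \<T> \<Omega> \<Gamma>D \<Gamma>g \<longleftrightarrow>
     (\<forall>T\<in>\<T>. \<forall>e. e edge_of T \<and> e \<subseteq> frontier \<Omega> \<longrightarrow>
        e \<subseteq> \<Gamma>D \<or> e \<subseteq> \<Gamma>g \<or> rel_interior e \<subseteq> frontier \<Omega> - (\<Gamma>D \<union> \<Gamma>g))"

definition hat_function :: "(real^2) set set \<Rightarrow> real^2 \<Rightarrow> (real^2 \<Rightarrow> real) \<Rightarrow> bool" where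
  "hat_function \<T> z \<phi> \<longleftrightarrow>
     continuous_on (\<Union>\<T>) \<phi> \<and> (\<forall>T\<in>\<T>. \<exists>a b. \<forall>x\<in>T. \<phi> x = a \<bullet> x + b) \<and>
     \<phi> z = 1 \<and> (\<forall>y\<in>nodes \<T> - {z}. \<phi> y = 0)"

definition FE_space :: "(real^2) set set \<Rightarrow> nat \<Rightarrow> vfield set \<Rightarrow> vfield set" where
  "FE_space \<T> k V =
     {v \<in> V. \<forall>T\<in>\<T>. \<forall>i. \<exists>c :: nat \<Rightarrow> nat \<Rightarrow> real. AE x in lebesgue_on T.
        v x $ i = (\<Sum>(p, q)\<in>{(p, q). p + q \<le> k}. c p q * (x $ 1) ^ p * (x $ 2) ^ q)}"

section \<open>Elasticity eigenvalue problems\<close>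

definition spd_tensor :: "tensor \<Rightarrow> bool" where
  "spd_tensor C \<longleftrightarrow>
     linear C \<and>
     (\<forall>A. transpose A = A \<longrightarrow> transpose (C A) = C A) \<and>
     (\<forall>A B. transpose A = A \<and> transpose B = B \<longrightarrow> C A \<bullet> B = A \<bullet> C B) \<and>
     (\<forall>A. transpose A = A \<and> A \<noteq> 0 \<longrightarrow> C A \<bullet> A > 0)"

definition tensor_sqrt :: "tensor \<Rightarrow> tensor \<Rightarrow> bool" where
  "tensor_sqrt C S \<longleftrightarrow> spd_tensor S \<and> (\<forall>A. transpose A = A \<longrightarrow> S (S A) = C A)"

definition a_form :: "(real^2) set \<Rightarrow> tensor \<Rightarrow> vfield \<Rightarrow> vfield \<Rightarrow> real" where
  "a_form \<Omega> C u v = (\<integral>x. C (strain \<Omega> u x) \<bullet> strain \<Omega> v x \<partial>lebesgue_on \<Omega>)"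

definition energy_norm :: "(real^2) set \<Rightarrow> tensor \<Rightarrow> vfield \<Rightarrow> real" where
  "energy_norm \<Omega> C v = sqrt (a_form \<Omega> C v v)"

definition eigenpair ::
    "(real^2) set \<Rightarrow> tensor \<Rightarrow> vfield set \<Rightarrow> real \<Rightarrow> vfield \<Rightarrow> bool" where
  "eigenpair \<Omega> C V \<kappa> u \<longleftrightarrow>
     \<kappa> \<ge> 0 \<and> u \<in> V \<and> l2_norm \<Omega> u = 1 \<and> (\<forall>v\<in>V. a_form \<Omega> C u v = \<kappa> * l2_inner \<Omega> u v)"

definition simple_eigenvalue :: "(real^2) set \<Rightarrow> tensor \<Rightarrow> vfield set \<Rightarrow> real \<Rightarrow> bool" where
  "simple_eigenvalue \<Omega> C V \<kappa> \<longleftrightarrow>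
     (\<exists>u. eigenpair \<Omega> C V \<kappa> u \<and>
        (\<forall>v. eigenpair \<Omega> C V \<kappa> v \<longrightarrow> (\<exists>s. AE x in lebesgue_on \<Omega>. v x = s *\<^sub>R u x)))"

text \<open>
  An increasing list \<open>ev 1 \<le> ev 2 \<le> \<dots>\<close> of all eigenvalues, repeated according to multiplicity: the
  orthonormal eigenfunctions belonging to the entries equal to \<open>\<kappa>\<close> span the eigenspace of \<open>\<kappa>\<close>.
  The list is finite for a finite element space and infinite for the continuous problem.
\<close>

definition eigenvalue_list ::
    "(real^2) set \<Rightarrow> tensor \<Rightarrow> vfield set \<Rightarrow> nat set \<Rightarrow> (nat \<Rightarrow> real) \<Rightarrow> (nat \<Rightarrow> vfield) \<Rightarrow> bool" where
  "eigenvalue_list \<Omega> C V J ev w \<longleftrightarrow>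
     (J = {1..} \<or> (\<exists>N. J = {1..N})) \<and>
     (\<forall>i\<in>J. eigenpair \<Omega> C V (ev i) (w i)) \<and>
     (\<forall>i\<in>J. \<forall>l\<in>J. i \<le> l \<longrightarrow> ev i \<le> ev l) \<and>
     (\<forall>i\<in>J. \<forall>l\<in>J. i \<noteq> l \<longrightarrow> l2_inner \<Omega> (w i) (w l) = 0) \<and>
     (\<forall>\<kappa> v. eigenpair \<Omega> C V \<kappa> v \<longrightarrow>
        finite {i\<in>J. ev i = \<kappa>} \<and>
        (AE x in lebesgue_on \<Omega>. v x = (\<Sum>i\<in>{i\<in>J. ev i = \<kappa>}. l2_inner \<Omega> v (w i) *\<^sub>R w i x)))"

definition eigenvalue_index ::
    "(real^2) set \<Rightarrow> tensor \<Rightarrow> vfield set \<Rightarrow> nat \<Rightarrow> real \<Rightarrow> bool" where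
  "eigenvalue_index \<Omega> C V j \<kappa> \<longleftrightarrow>
     (\<exists>J ev w. eigenvalue_list \<Omega> C V J ev w \<and> j \<in> J \<and> ev j = \<kappa>)"

section \<open>Residual and estimator\<close>

definition residual ::
    "(real^2) set \<Rightarrow> tensor \<Rightarrow> real \<Rightarrow> vfield \<Rightarrow> vfield \<Rightarrow> real" where
  "residual \<Omega> C \<kappa>h uh v = \<kappa>h * l2_inner \<Omega> uh v - a_form \<Omega> C uh v"

definition weighted_strain_norm ::
    "(real^2) set \<Rightarrow> tensor \<Rightarrow> (real^2 \<Rightarrow> real) \<Rightarrow> vfield \<Rightarrow> real" where
  "weighted_strain_norm \<Omega> S \<phi> v =
     l2_norm {x\<in>\<Omega>. \<phi> x \<noteq> 0} (\<lambda>x. sqrt (\<phi> x) *\<^sub>R S (strain \<Omega> v x))"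

text \<open>
  The supremum may be infinite, namely if \<open>residual\<close> does not vanish on \<open>\<phi> v\<close> for some \<open>v\<close> that
  is a rigid body motion where \<open>\<phi>\<close> is nonzero. It is therefore taken in the extended reals.
\<close>

definition local_estimator ::
    "(real^2) set \<Rightarrow> tensor \<Rightarrow> tensor \<Rightarrow> vfield set \<Rightarrow> real \<Rightarrow> vfield \<Rightarrow> (real^2 \<Rightarrow> real) \<Rightarrow> ereal" where
  "local_estimator \<Omega> C S V \<kappa>h uh \<phi> =
     (SUP v\<in>{v\<in>V. weighted_strain_norm \<Omega> S \<phi> v \<noteq> 0}.
        ereal (residual \<Omega> C \<kappa>h uh (\<lambda>x. \<phi> x *\<^sub>R v x) / weighted_strain_norm \<Omega> S \<phi> v))"

definition sqrt_ereal :: "ereal \<Rightarrow> ereal" where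
  "sqrt_ereal s = (if s = \<infinity> then \<infinity> else ereal (sqrt (real_of_ereal s)))"

definition estimator ::
    "(real^2) set \<Rightarrow> tensor \<Rightarrow> tensor \<Rightarrow> vfield set \<Rightarrow> real \<Rightarrow> vfield \<Rightarrow>
     (real^2) set \<Rightarrow> (real^2 \<Rightarrow> real^2 \<Rightarrow> real) \<Rightarrow> ereal" where
  "estimator \<Omega> C S V \<kappa>h uh N \<phi> =
     sqrt_ereal (\<Sum>z\<in>N. (local_estimator \<Omega> C S V \<kappa>h uh (\<phi> z))\<^sup>2)"

end

theory Submission
  imports Defs "HOL-Computational_Algebra.Polynomial"
begin

text \<open>
  Since the hat functions form a partition of unity, the residual of the error splits into local
  residuals, and the Cauchy--Schwarz inequality bounds it by \<open>\<mu>\<close> times the energy norm of the error.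
  A hat function for which the weighted strain norm of the error vanishes does no harm: shifting a
  test function by multiples of the error leaves its weighted norm unchanged, so a finite supremum
  forces the local residual of the error to be nonpositive. The remaining term of the energy norm
  is \<open>(\<kappa> + \<kappa>h) / 2\<close> times the squared \<open>L\<^sup>2\<close> error, which \<open>\<kappa> \<le> \<kappa>h\<close> turns into a product of the two norms.

  The analytic input is that weak gradients are unique, hence linear in the function, and that a
  hat function times an \<open>H\<^sup>1\<close> function is in \<open>H\<^sup>1\<close>. For the latter the hat function is mollified: in the
  interior of a triangle the gradients of the mollified functions are eventually constant, and
  elsewhere they are bounded by the Lipschitz constant.
\<close>

subsection \<open>Smooth functions on the plane\<close>

text \<open>\<open>grad\<close> is a Hilbert choice, so the calculus rules for gradients and strains
  hold almost everywhere and only for functions in \<open>H1\<close>; nothing is known about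
  \<open>a_form\<close> elsewhere. Hence \<open>\<phi> z x *\<^sub>R v x\<close> must be placed in
  \<open>H1\<close> before the residual can be split into local ones. The obstacle is that
  \<open>weak_gradient\<close> admits only infinitely differentiable test functions, while a hat
  function times such a function is merely Lipschitz. Multiplying by a mollified hat function gives
  an admissible test function again, and the product rule survives in the limit. A vanishing
  weighted norm is delicate because \<open>local_estimator\<close> then leaves the error out of its
  supremum, so that no term of it bounds the local residual of the error directly. The weights
  \<open>\<phi> z\<close> sum to 1, so the squared weighted norms sum exactly to the squared energy
  norm. The argument therefore yields the factor 1 in front of the estimator, which is at most
  \<open>sqrt 3\<close>.\<close>

lemma partial_eqI: "(f has_derivative f') (at x) \<Longrightarrow> partial j f x = f' (axis j 1)"
  by (metis frechet_derivative_at partial_def)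

text \<open>The regularity half of \<open>test_function\<close>; mollified functions satisfy it
  without being supported in the domain.\<close>

definition smooth :: "(real^2 \<Rightarrow> real) \<Rightarrow> bool" where
  "smooth f \<longleftrightarrow> (\<forall>k. Ck k f)"

lemma smooth_differentiable: "smooth f \<Longrightarrow> f differentiable (at x)"
  using Ck.simps(2)[of 0 f] unfolding smooth_def differentiable_on_def by (metis UNIV_I)

lemma smooth_partial: "smooth f \<Longrightarrow> smooth (partial j f)"
  unfolding smooth_def by (metis Ck.simps(2))

text \<open>Induction on the order \<open>k\<close> with \<open>f\<close> arbitrary, since
  \<open>Ck (Suc k)\<close> asks for \<open>Ck k\<close> of the partials. It replaces formulas for
  higher derivatives: each use only has to name a class closed under \<open>partial\<close>.\<close>

lemma smooth_coinduct:
  assumes "P f"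
    and step: "\<And>f. P f \<Longrightarrow> f differentiable_on UNIV \<and> (\<forall>j. P (partial j f))"
  shows "smooth f"
proof -
  have "Ck k f" if "P f" for k f
    using that
  proof (induction k arbitrary: f)
    case 0
    then show ?case using step differentiable_imp_continuous_on by auto
  next
    case (Suc k)
    then show ?case using step by auto
  qed
  then show ?thesis using assms(1) by (auto simp: smooth_def)
qed

lemma smooth_continuous: "smooth f \<Longrightarrow> continuous_on S f"
  unfolding smooth_def by (metis Ck.simps(1) continuous_on_subset subset_UNIV)

lemma smooth_measurable: "smooth f \<Longrightarrow> f \<in> borel_measurable borel"
  using smooth_continuous borel_measurable_continuous_onI by blast

text \<open>\<open>smooth\<close> includes Frechet differentiability, so expanding the increment in
  the axis basis is enough. In this form the derivative depends on \<open>x\<close> through smooth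
  partials only, as the Leibniz rule for parameter integrals requires.\<close>

lemma smooth_has_derivative:
  assumes "smooth f"
  shows "(f has_derivative (\<lambda>h. \<Sum>j\<in>UNIV. h $ j * partial j f x)) (at x)"
proof -
  have D: "(f has_derivative frechet_derivative f (at x)) (at x)"
    using smooth_differentiable[OF assms] frechet_derivative_works by blast
  have lin: "linear (frechet_derivative f (at x))"
    using D has_derivative_linear by blast
  have "frechet_derivative f (at x) h = (\<Sum>j\<in>UNIV. h $ j * partial j f x)" for h
  proof -
    have "h = (\<Sum>j\<in>UNIV. h $ j *\<^sub>R axis j 1)"
      by (simp add: vec_eq_iff axis_def if_distrib sum.If_cases cong: if_cong)
    then have "frechet_derivative f (at x) h = frechet_derivative f (at x) (\<Sum>j\<in>UNIV. h $ j *\<^sub>R axis j 1)"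
      by simp
    also have "\<dots> = (\<Sum>j\<in>UNIV. h $ j * partial j f x)"
      using lin by (simp add: linear_sum linear_cmul partial_def)
    finally show ?thesis .
  qed
  then show ?thesis using D by (metis (no_types, lifting) ext)
qed

lemma partial_mult:
  assumes "f differentiable (at x)" "g differentiable (at x)"
  shows "partial j (\<lambda>x. f x * g x) x = f x * partial j g x + partial j f x * g x"
  unfolding partial_def
  using partial_eqI[OF has_derivative_mult[OF frechet_derivative_works[THEN iffD1, OF assms(1)] frechet_derivative_works[THEN iffD1, OF assms(2)]]]
  by (simp add: partial_def)

lemma smooth_mult:
  assumes "smooth f" "smooth g"
  shows "smooth (\<lambda>x. f x * g x)"
proof -
  \<comment> \<open>The derivatives of a product are sums of products, so these have to be included.\<close>
  define P where "P h \<longleftrightarrow> (\<exists>F. (\<forall>p\<in>set F. smooth (fst p) \<and> smooth (snd p)) \<and>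
      h = (\<lambda>x. \<Sum>p\<leftarrow>F. fst p x * snd p x))" for h :: "real^2 \<Rightarrow> real"
  have der: "((\<lambda>x. \<Sum>p\<leftarrow>F. fst p x * snd p x) has_derivative
        (\<lambda>h. \<Sum>p\<leftarrow>F. fst p x * frechet_derivative (snd p) (at x) h
                     + frechet_derivative (fst p) (at x) h * snd p x)) (at x)"
    if "\<forall>p\<in>set F. smooth (fst p) \<and> smooth (snd p)" for F x
    using that
  proof (induction F)
    case (Cons p F)
    show ?case
      using Cons by (auto intro!: has_derivative_add has_derivative_mult smooth_differentiable
          frechet_derivative_works[THEN iffD1])
  qed simp
  have "P (\<lambda>x. f x * g x)"
    unfolding P_def by (rule exI[of _ "[(f, g)]"]) (use assms in auto)
  then show ?thesis
  proof (rule smooth_coinduct)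
    fix h assume "P h"
    then obtain F where F: "\<forall>p\<in>set F. smooth (fst p) \<and> smooth (snd p)"
      and h: "h = (\<lambda>x. \<Sum>p\<leftarrow>F. fst p x * snd p x)"
      unfolding P_def by blast
    have "P (partial j h)" for j
      unfolding P_def
    proof (intro exI conjI)
      let ?F = "concat (map (\<lambda>p. [(fst p, partial j (snd p)), (partial j (fst p), snd p)]) F)"
      show "\<forall>p\<in>set ?F. smooth (fst p) \<and> smooth (snd p)"
        using F by (auto simp: smooth_partial)
      show "partial j h = (\<lambda>x. \<Sum>p\<leftarrow>?F. fst p x * snd p x)"
      proof
        fix x
        have "partial j h x = (\<Sum>p\<leftarrow>F. fst p x * partial j (snd p) x + partial j (fst p) x * snd p x)"
          unfolding h using partial_eqI[OF der[OF F]] by (simp add: partial_def)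
        also have "\<dots> = (\<Sum>p\<leftarrow>?F. fst p x * snd p x)"
          by (induction F) (auto simp: algebra_simps)
        finally show "partial j h x = (\<Sum>p\<leftarrow>?F. fst p x * snd p x)" .
      qed
    qed
    moreover have "h differentiable_on UNIV"
      unfolding h differentiable_on_def using der[OF F] differentiable_def by blast
    ultimately show "h differentiable_on UNIV \<and> (\<forall>j. P (partial j h))" by blast
  qed
qed

lemma smooth_const: "smooth (\<lambda>x. c)"
proof (rule smooth_coinduct[where P = "\<lambda>f. \<exists>c. f = (\<lambda>x. c)"])
  fix f :: "real^2 \<Rightarrow> real" assume "\<exists>c. f = (\<lambda>x. c)"
  then obtain c where f: "f = (\<lambda>x. c)" by blast
  have "partial j f = (\<lambda>x. 0)" for j
    unfolding f by (rule ext, rule partial_eqI) auto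
  then show "f differentiable_on UNIV \<and> (\<forall>j. \<exists>c. partial j f = (\<lambda>x. c))"
    by (auto simp: f)
qed auto

subsection \<open>Smooth bump functions on boxes\<close>

text \<open>The derivatives of \<open>exp (-1/t)\<close> have the form \<open>poly p (1/t) * exp (-1/t)\<close>.\<close>

definition flat_exp :: "real poly \<Rightarrow> real \<Rightarrow> real" where
  "flat_exp p t = (if t \<le> 0 then 0 else poly p (1/t) * exp (-1/t))"

text \<open>The extra power \<open>s ^ k\<close> makes the induction work:
  \<open>poly (pCons a p) s\<close> is \<open>a + s * poly p s\<close>, and the new factor
  \<open>s\<close> is absorbed into the power.\<close>

lemma tendsto_poly_div_exp: "((\<lambda>s::real. s ^ k * poly p s / exp s) \<longlongrightarrow> 0) at_top"
proof (induction p arbitrary: k)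
  case (pCons a p)
  have "((\<lambda>s. a * (s ^ k / exp s) + s ^ Suc k * poly p s / exp s) \<longlongrightarrow> a * 0 + 0) at_top"
    by (intro tendsto_intros tendsto_power_div_exp_0 pCons)
  moreover have "(\<lambda>s. a * (s ^ k / exp s) + s ^ Suc k * poly p s / exp s)
      = (\<lambda>s. s ^ k * poly (pCons a p) s / exp s)"
    by (auto simp: field_simps)
  ultimately show ?case by simp
qed simp

text \<open>With s = 1/t, the derivative of p(s) exp(-s) in t > 0 is s^2 (p - p')(s) exp(-s);
  \<open>[:0, 0, 1:]\<close> is the polynomial s^2.\<close>

lemma DERIV_flat_exp:
  "(flat_exp p has_real_derivative flat_exp ([:0, 0, 1:] * (p - pderiv p)) t) (at t)"
proof (cases t "0::real" rule: linorder_cases)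
  case less
  have "((\<lambda>t. 0) has_real_derivative 0) (at t)" by simp
  then have "(flat_exp p has_real_derivative 0) (at t)"
    by (rule has_field_derivative_transform_within_open[where S = "{..<0}"])
       (use less in \<open>auto simp: flat_exp_def\<close>)
  then show ?thesis using less by (simp add: flat_exp_def)
next
  case greater
  have "((\<lambda>t. poly p (1/t) * exp (-1/t)) has_real_derivative
      flat_exp ([:0, 0, 1:] * (p - pderiv p)) t) (at t)"
    using greater
    by (auto intro!: derivative_eq_intros DERIV_chain2[OF poly_DERIV]
        simp: flat_exp_def field_simps power2_eq_square)
  then show ?thesis
    by (rule has_field_derivative_transform_within_open[where S = "{0<..}"])
       (use greater in \<open>auto simp: flat_exp_def\<close>)
next
  case equal
  \<comment> \<open>With s = 1/h the difference quotient at 0 is s p(s) / exp s, the case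
    \<open>k = 1\<close> of \<open>tendsto_poly_div_exp\<close>.\<close>
  have R: "((\<lambda>h. flat_exp p h / h) \<longlongrightarrow> 0) (at_right 0)"
  proof (rule Lim_transform_eventually)
    show "((\<lambda>h::real. inverse h ^ 1 * poly p (inverse h) / exp (inverse h)) \<longlongrightarrow> 0) (at_right 0)"
      by (rule filterlim_compose[OF tendsto_poly_div_exp filterlim_inverse_at_top_right])
    show "\<forall>\<^sub>F h in at_right 0. inverse h ^ 1 * poly p (inverse h) / exp (inverse h) = flat_exp p h / h"
      using eventually_at_right_less[of "0::real"]
      by (rule eventually_mono) (auto simp: flat_exp_def field_simps exp_minus)
  qed
  have L: "((\<lambda>h. flat_exp p h / h) \<longlongrightarrow> 0) (at_left 0)"
  proof (rule Lim_transform_eventually)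
    show "\<forall>\<^sub>F h in at_left 0. 0 = flat_exp p h / h"
      by (auto simp: flat_exp_def eventually_at_filter)
  qed simp
  have "((\<lambda>h. flat_exp p h / h) \<longlongrightarrow> 0) (at 0)"
    using L R filterlim_split_at by blast
  then show ?thesis using equal by (simp add: DERIV_def flat_exp_def)
qed

text \<open>The scalar \<open>a\<close> in the class collects the factors \<open>c $ j\<close> that
  the chain rule produces.\<close>

lemma smooth_flat_exp: "smooth (\<lambda>x. flat_exp p (c \<bullet> x + d))"
proof (rule smooth_coinduct[where P = "\<lambda>f. \<exists>a p. f = (\<lambda>x. a * flat_exp p (c \<bullet> x + d))"])
  show "\<exists>a q. (\<lambda>x. flat_exp p (c \<bullet> x + d)) = (\<lambda>x. a * flat_exp q (c \<bullet> x + d))"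
    by (intro exI[of _ 1] exI[of _ p]) simp
next
  fix f assume "\<exists>a p. f = (\<lambda>x. a * flat_exp p (c \<bullet> x + d))"
  then obtain a p where f: "f = (\<lambda>x. a * flat_exp p (c \<bullet> x + d))" by blast
  let ?q = "[:0, 0, 1:] * (p - pderiv p)"
  have D: "(f has_derivative (\<lambda>h. a * (flat_exp ?q (c \<bullet> x + d) * (c \<bullet> h)))) (at x)" for x
    unfolding f
    by (intro has_derivative_mult_right
        has_derivative_compose[OF _ DERIV_flat_exp[THEN has_field_derivative_imp_has_derivative]])
       (auto intro!: derivative_eq_intros)
  have "partial j f = (\<lambda>x. (a * (c $ j)) * flat_exp ?q (c \<bullet> x + d))" for j
    using partial_eqI[OF D] by (auto simp: inner_axis)
  then show "f differentiable_on UNIV \<and> (\<forall>j. \<exists>a p. partial j f = (\<lambda>x. a * flat_exp p (c \<bullet> x + d)))"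
    using D unfolding differentiable_on_def differentiable_def by blast
qed

text \<open>\<open>flat_exp 1\<close> is exp(-1/t) continued by 0. For \<open>n > 0\<close> each
  factor is positive on one side of an edge line, so the product is positive exactly in
  \<open>box c d\<close>; as \<open>n\<close> grows, every factor tends to 1 there.\<close>

definition bump :: "real^2 \<Rightarrow> real^2 \<Rightarrow> real \<Rightarrow> real^2 \<Rightarrow> real" where
  "bump c d n x =
     (flat_exp 1 (n * (x $ 1 - c $ 1)) * flat_exp 1 (n * (d $ 1 - x $ 1))) *
     (flat_exp 1 (n * (x $ 2 - c $ 2)) * flat_exp 1 (n * (d $ 2 - x $ 2)))"

lemma smooth_bump: "smooth (bump c d n)"
proof -
  have 1: "smooth (\<lambda>x. flat_exp 1 (n * (x $ i - c $ i)))" for i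
    using smooth_flat_exp[of 1 "n *\<^sub>R axis i 1" "- n * c $ i"]
    by (simp add: inner_axis' algebra_simps)
  have 2: "smooth (\<lambda>x. flat_exp 1 (n * (d $ i - x $ i)))" for i
    using smooth_flat_exp[of 1 "(-n) *\<^sub>R axis i 1" "n * d $ i"]
    by (simp add: inner_axis' algebra_simps)
  show ?thesis
    unfolding bump_def[abs_def] by (intro smooth_mult 1 2)
qed

lemma flat_exp_1_bounds: "0 \<le> flat_exp 1 t" "flat_exp 1 t \<le> 1"
  by (auto simp: flat_exp_def)

lemma bump_bounds: "0 \<le> bump c d n x" "bump c d n x \<le> 1"
  unfolding bump_def by (auto intro!: mult_nonneg_nonneg mult_le_one flat_exp_1_bounds)

lemma bump_eq_0: "n > 0 \<Longrightarrow> x \<notin> box c d \<Longrightarrow> bump c d n x = 0"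
  by (auto simp: bump_def flat_exp_def mem_box_cart forall_2 mult_le_0_iff)

lemma bump_pos: "n > 0 \<Longrightarrow> x \<in> box c d \<Longrightarrow> bump c d n x > 0"
  by (auto simp: bump_def flat_exp_def mem_box_cart forall_2 mult_le_0_iff)

lemma bump_tendsto: "(\<lambda>n. bump c d (real (Suc n)) x) \<longlonglongrightarrow> indicator (box c d) x"
proof (cases "x \<in> box c d")
  case True
  have *: "(\<lambda>n. flat_exp 1 (real (Suc n) * t)) \<longlonglongrightarrow> 1" if "t > 0" for t :: real
  proof -
    have "(\<lambda>n. exp (- (1/t) * (1 / real (Suc n)))) \<longlonglongrightarrow> exp (- (1/t) * 0)"
      by (intro tendsto_intros lim_1_over_n[THEN LIMSEQ_Suc])
    moreover have "flat_exp 1 (real (Suc n) * t) = exp (- (1/t) * (1 / real (Suc n)))" for n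
      using that by (simp add: flat_exp_def mult_le_0_iff)
    ultimately show ?thesis by (simp del: of_nat_Suc)
  qed
  have "(\<lambda>n. bump c d (real (Suc n)) x) \<longlonglongrightarrow> (1 * 1) * (1 * 1)"
    unfolding bump_def
    by (intro tendsto_mult *) (use True in \<open>auto simp: mem_box_cart\<close>)
  then show ?thesis using True by simp
qed (simp add: bump_eq_0)

lemma test_function_bump:
  assumes "cbox c d \<subseteq> \<Omega>" "n > 0"
  shows "test_function \<Omega> (bump c d n)"
  unfolding test_function_def
  using smooth_bump[of c d n] assms bump_eq_0[of n _ c d] box_subset_cbox[of c d]
  by (auto simp: smooth_def intro!: exI[of _ "cbox c d"])

subsection \<open>Square integrable functions\<close>

lemma norm_add_square_le: "(norm (x + y))\<^sup>2 \<le> 2 * (norm x)\<^sup>2 + 2 * (norm y)\<^sup>2"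
  for x y :: "'a::real_normed_vector"
proof -
  have "(norm (x + y))\<^sup>2 \<le> (norm x + norm y)\<^sup>2"
    by (intro power_mono norm_triangle_ineq norm_ge_zero)
  also have "\<dots> \<le> 2 * (norm x)\<^sup>2 + 2 * (norm y)\<^sup>2"
    using zero_le_power2[of "norm x - norm y"] by (simp add: power2_sum power2_diff)
  finally show ?thesis .
qed

lemma integrable_mult_bounded:
  fixes f m :: "'a \<Rightarrow> real"
  assumes "integrable M f" "m \<in> borel_measurable M" "\<And>x. x \<in> space M \<Longrightarrow> \<bar>m x\<bar> \<le> B"
  shows "integrable M (\<lambda>x. f x * m x)"
proof (rule Bochner_Integration.integrable_bound)
  show "integrable M (\<lambda>x. f x * B)" using assms(1) by simp
  show "(\<lambda>x. f x * m x) \<in> borel_measurable M" using assms by measurable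
  show "AE x in M. norm (f x * m x) \<le> norm (f x * B)"
    using assms(3) by (intro AE_I2) (fastforce simp: abs_mult intro!: mult_left_mono)
qed

lemma square_integrable_measurable:
  "square_integrable S f \<Longrightarrow> f \<in> borel_measurable (lebesgue_on S)"
  by (simp add: square_integrable_def)

lemma square_integrable_dominated:
  assumes f: "f \<in> borel_measurable (lebesgue_on S)" and g: "square_integrable S g"
    and le: "\<And>x. x \<in> S \<Longrightarrow> norm (f x) \<le> c * norm (g x)"
  shows "square_integrable S f"
  unfolding square_integrable_def
proof (intro conjI f, rule Bochner_Integration.integrable_bound)
  show "integrable (lebesgue_on S) (\<lambda>x. c\<^sup>2 * (norm (g x))\<^sup>2)"
    using g by (simp add: square_integrable_def)
  show "(\<lambda>x. (norm (f x))\<^sup>2) \<in> borel_measurable (lebesgue_on S)"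
    using f by measurable
  show "AE x in lebesgue_on S. norm ((norm (f x))\<^sup>2) \<le> norm (c\<^sup>2 * (norm (g x))\<^sup>2)"
    using power_mono[OF le norm_ge_zero, of _ 2] by (intro AE_I2) (simp add: power_mult_distrib)
qed

lemma square_integrable_add:
  assumes f: "square_integrable S f" and g: "square_integrable S g"
  shows "square_integrable S (\<lambda>x. f x + g x)"
  unfolding square_integrable_def
proof (intro conjI, goal_cases)
  case 1
  then show ?case using f g by (auto simp: square_integrable_def)
next
  case 2
  have [measurable]: "f \<in> borel_measurable (lebesgue_on S)" "g \<in> borel_measurable (lebesgue_on S)"
    using f g by (auto simp: square_integrable_def)
  show ?case
  proof (rule Bochner_Integration.integrable_bound)
    show "integrable (lebesgue_on S) (\<lambda>x. 2 * (norm (f x))\<^sup>2 + 2 * (norm (g x))\<^sup>2)"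
      using f g by (simp add: square_integrable_def)
    show "(\<lambda>x. (norm (f x + g x))\<^sup>2) \<in> borel_measurable (lebesgue_on S)"
      by measurable
    show "AE x in lebesgue_on S. norm ((norm (f x + g x))\<^sup>2)
        \<le> norm (2 * (norm (f x))\<^sup>2 + 2 * (norm (g x))\<^sup>2)"
      by (intro AE_I2) (use norm_add_square_le in auto)
  qed
qed

lemma square_integrable_linear:
  assumes "linear A" and f: "square_integrable S f"
  shows "square_integrable S (\<lambda>x. A (f x))"
proof -
  obtain B where "\<And>x. norm (A x) \<le> B * norm x"
    using linear_bounded[OF assms(1)] by blast
  moreover have "(\<lambda>x. A (f x)) \<in> borel_measurable (lebesgue_on S)"
    using square_integrable_measurable[OF f]
    by (intro borel_measurable_continuous_on[of A])
       (auto simp: linear_continuous_on assms(1) linear_conv_bounded_linear[symmetric])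
  ultimately show ?thesis
    using f by (auto intro: square_integrable_dominated[OF _ f, of _ B])
qed

lemma square_integrable_scaleR: "square_integrable S f \<Longrightarrow> square_integrable S (\<lambda>x. c *\<^sub>R f x)"
  by (rule square_integrable_linear[of "\<lambda>x. c *\<^sub>R x"]) (auto simp: linear_scale_self)

lemma square_integrable_component:
  fixes f :: "'a::euclidean_space \<Rightarrow> 'b::euclidean_space^'n"
  shows "square_integrable S f \<Longrightarrow> square_integrable S (\<lambda>x. f x $ i)"
  by (rule square_integrable_linear[of "\<lambda>x. x $ i"]) (auto intro: bounded_linear.linear bounded_linear_vec_nth)

lemma square_integrable_inner:
  assumes f: "square_integrable S f" and g: "square_integrable S g"
  shows "integrable (lebesgue_on S) (\<lambda>x. f x \<bullet> g x)"
proof (rule Bochner_Integration.integrable_bound)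
  have [measurable]: "f \<in> borel_measurable (lebesgue_on S)" "g \<in> borel_measurable (lebesgue_on S)"
    using f g by (auto simp: square_integrable_def)
  show "integrable (lebesgue_on S) (\<lambda>x. (norm (f x))\<^sup>2 + (norm (g x))\<^sup>2)"
    using f g by (simp add: square_integrable_def)
  show "(\<lambda>x. f x \<bullet> g x) \<in> borel_measurable (lebesgue_on S)" by measurable
  have "\<bar>f x \<bullet> g x\<bar> \<le> (norm (f x))\<^sup>2 + (norm (g x))\<^sup>2" for x
  proof -
    have "\<bar>f x \<bullet> g x\<bar> \<le> norm (f x) * norm (g x)" by (rule Cauchy_Schwarz_ineq2)
    also have "\<dots> \<le> (norm (f x))\<^sup>2 + (norm (g x))\<^sup>2"
      using sum_squares_bound[of "norm (f x)" "norm (g x)"]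
        mult_nonneg_nonneg[OF norm_ge_zero norm_ge_zero, of "f x" "g x"] by linarith
    finally show ?thesis .
  qed
  then show "AE x in lebesgue_on S. norm (f x \<bullet> g x) \<le> norm ((norm (f x))\<^sup>2 + (norm (g x))\<^sup>2)"
    by (intro AE_I2) simp
qed

lemma square_integrable_imp_integrable:
  fixes f :: "'a::euclidean_space \<Rightarrow> 'b::euclidean_space"
  assumes f: "square_integrable S f" and S: "S \<in> lmeasurable"
  shows "integrable (lebesgue_on S) f"
proof (rule Bochner_Integration.integrable_bound)
  interpret finite_measure "lebesgue_on S" by (rule finite_measure_lebesgue_on[OF S])
  show "integrable (lebesgue_on S) (\<lambda>x. 1 + (norm (f x))\<^sup>2)"
    using f by (simp add: square_integrable_def)
  show "f \<in> borel_measurable (lebesgue_on S)" using f by (simp add: square_integrable_def)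
  have "y \<le> 1 + y\<^sup>2" if "0 \<le> y" for y :: real
    using zero_le_power2[of "y - 1"] that by (simp add: power2_diff)
  then show "AE x in lebesgue_on S. norm (f x) \<le> norm (1 + (norm (f x))\<^sup>2)"
    by (intro AE_I2) simp
qed

lemma l2_norm_nonneg: "0 \<le> l2_norm S f"
  unfolding l2_norm_def by simp

lemma l2_norm_square: "(l2_norm S f)\<^sup>2 = (\<integral>x. (norm (f x))\<^sup>2 \<partial>lebesgue_on S)"
  unfolding l2_norm_def by (simp add: integral_nonneg)

lemma l2_norm_cong_AE:
  assumes "AE x in lebesgue_on S. f x = g x"
    and "f \<in> borel_measurable (lebesgue_on S)" "g \<in> borel_measurable (lebesgue_on S)"
  shows "l2_norm S f = l2_norm S g"
proof -
  have "(\<integral>x. (norm (f x))\<^sup>2 \<partial>lebesgue_on S) = (\<integral>x. (norm (g x))\<^sup>2 \<partial>lebesgue_on S)"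
    by (rule integral_cong_AE) (use assms in \<open>auto elim: eventually_mono\<close>)
  then show ?thesis by (simp add: l2_norm_def)
qed

text \<open>Comparing squares through \<open>norm_add_square_le\<close> takes the place of
  Minkowski's inequality; the factor 2 is harmless for null sequences.\<close>

lemma l2_norm_lincomb_tendsto_0:
  assumes f: "\<And>n. square_integrable S (f n)" and g: "\<And>n. square_integrable S (g n)"
    and "(\<lambda>n. l2_norm S (f n)) \<longlonglongrightarrow> 0" "(\<lambda>n. l2_norm S (g n)) \<longlonglongrightarrow> 0"
  shows "(\<lambda>n. l2_norm S (\<lambda>x. f n x + t *\<^sub>R g n x)) \<longlonglongrightarrow> 0"
proof -
  have "(\<lambda>n. 2 * (l2_norm S (f n))\<^sup>2 + 2 * t\<^sup>2 * (l2_norm S (g n))\<^sup>2) \<longlonglongrightarrow> 2 * 0\<^sup>2 + 2 * t\<^sup>2 * 0\<^sup>2"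
    by (intro tendsto_intros assms)
  then have lim: "(\<lambda>n. 2 * (l2_norm S (f n))\<^sup>2 + 2 * t\<^sup>2 * (l2_norm S (g n))\<^sup>2) \<longlonglongrightarrow> 0" by simp
  have le: "(l2_norm S (\<lambda>x. f n x + t *\<^sub>R g n x))\<^sup>2
      \<le> 2 * (l2_norm S (f n))\<^sup>2 + 2 * t\<^sup>2 * (l2_norm S (g n))\<^sup>2" for n
  proof -
    have "(\<integral>x. (norm (f n x + t *\<^sub>R g n x))\<^sup>2 \<partial>lebesgue_on S)
        \<le> (\<integral>x. 2 * (norm (f n x))\<^sup>2 + 2 * t\<^sup>2 * (norm (g n x))\<^sup>2 \<partial>lebesgue_on S)"
    proof (rule integral_mono)
      show "integrable (lebesgue_on S) (\<lambda>x. (norm (f n x + t *\<^sub>R g n x))\<^sup>2)"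
        using square_integrable_add[OF f square_integrable_scaleR[OF g]]
        by (simp add: square_integrable_def)
      show "integrable (lebesgue_on S) (\<lambda>x. 2 * (norm (f n x))\<^sup>2 + 2 * t\<^sup>2 * (norm (g n x))\<^sup>2)"
        using f[of n] g[of n] by (simp add: square_integrable_def)
      show "(norm (f n x + t *\<^sub>R g n x))\<^sup>2 \<le> 2 * (norm (f n x))\<^sup>2 + 2 * t\<^sup>2 * (norm (g n x))\<^sup>2" for x
        using norm_add_square_le[of "f n x" "t *\<^sub>R g n x"] by (simp add: power_mult_distrib)
    qed
    also have "\<dots> = 2 * (l2_norm S (f n))\<^sup>2 + 2 * t\<^sup>2 * (l2_norm S (g n))\<^sup>2"
      using f[of n] g[of n] by (simp add: l2_norm_square square_integrable_def)
    finally show ?thesis by (simp add: l2_norm_square)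
  qed
  have "(\<lambda>n. (l2_norm S (\<lambda>x. f n x + t *\<^sub>R g n x))\<^sup>2) \<longlonglongrightarrow> 0"
    by (rule tendsto_sandwich[OF _ _ tendsto_const lim]) (use le in auto)
  then have "(\<lambda>n. sqrt ((l2_norm S (\<lambda>x. f n x + t *\<^sub>R g n x))\<^sup>2)) \<longlonglongrightarrow> sqrt 0"
    by (rule tendsto_real_sqrt)
  then show ?thesis by (simp add: l2_norm_nonneg)
qed

subsection \<open>Uniqueness of weak gradients\<close>

text \<open>The complement of the compact \<open>K\<close> is open, so \<open>\<psi>\<close> is
  locally zero there and its partial derivatives vanish too.\<close>

lemma test_function_support:
  assumes "test_function \<Omega> \<psi>"
  obtains K where "compact K" "K \<subseteq> \<Omega>" "\<And>x. x \<notin> K \<Longrightarrow> \<psi> x = 0" "\<And>x j. x \<notin> K \<Longrightarrow> partial j \<psi> x = 0"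
proof -
  obtain K where K: "compact K" "K \<subseteq> \<Omega>" and 0: "\<And>x. x \<notin> K \<Longrightarrow> \<psi> x = 0"
    using assms unfolding test_function_def by blast
  have "partial j \<psi> x = 0" if "x \<notin> K" for x j
  proof (rule partial_eqI)
    have "((\<lambda>x. 0) has_derivative (\<lambda>h. 0)) (at x)" by simp
    then show "(\<psi> has_derivative (\<lambda>h. 0)) (at x)"
      by (rule has_derivative_transform_within_open[where s = "- K"])
         (use that 0 compact_imp_closed[OF K(1)] in auto)
  qed
  then show thesis using that K 0 by blast
qed

lemma test_function_bounded:
  assumes "test_function \<Omega> \<psi>"
  obtains B where "\<And>x. \<bar>\<psi> x\<bar> \<le> B" "\<And>x j. \<bar>partial j \<psi> x\<bar> \<le> B"
proof -
  obtain K where K: "compact K" and 0: "\<And>x. x \<notin> K \<Longrightarrow> \<psi> x = 0"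
    and d0: "\<And>x j. x \<notin> K \<Longrightarrow> partial j \<psi> x = 0"
    using test_function_support[OF assms] by metis
  have sm: "smooth \<psi>"
    using assms unfolding test_function_def smooth_def by blast
  have bd: "\<exists>B. \<forall>x. \<bar>f x\<bar> \<le> B" if "smooth f" "\<And>x. x \<notin> K \<Longrightarrow> f x = 0" for f
  proof -
    have "bounded (f ` K)"
      by (intro compact_imp_bounded compact_continuous_image smooth_continuous K that)
    then obtain B where "\<And>x. x \<in> K \<Longrightarrow> \<bar>f x\<bar> \<le> B" unfolding bounded_iff by auto
    then have "\<bar>f x\<bar> \<le> max B 0" for x by (cases "x \<in> K") (auto simp: that(2) intro: le_max_iff_disj[THEN iffD2])
    then show ?thesis by blast
  qed
  obtain B0 where B0: "\<And>x. \<bar>\<psi> x\<bar> \<le> B0" using bd[OF sm 0] by blast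
  have "\<forall>j. \<exists>B. \<forall>x. \<bar>partial j \<psi> x\<bar> \<le> B" using bd[OF smooth_partial[OF sm] d0] by blast
  then obtain B where B: "\<And>j x. \<bar>partial j \<psi> x\<bar> \<le> B j" by metis
  have "\<bar>partial j \<psi> x\<bar> \<le> max B0 (max (B 1) (B 2))" for j x
    using B[of j x] exhaust_2[of j] by auto
  moreover have "\<bar>\<psi> x\<bar> \<le> max B0 (max (B 1) (B 2))" for x
    using B0[of x] by linarith
  ultimately show thesis using that by blast
qed

lemma smooth_measurable_lebesgue_on:
  assumes "smooth f" shows "f \<in> borel_measurable (lebesgue_on S)"
  using smooth_measurable[OF assms] borel_measurable_subalgebra[of borel lebesgue f]
  by (metis measurable_completion measurable_lborel2 measurable_restrict_space1)

text \<open>The bumps are test functions with values in [0,1] that tend to the indicator of the box,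
  so dominated convergence applies with the majorant |F|.\<close>

lemma integral_box_eq_0:
  fixes F :: "real^2 \<Rightarrow> real"
  assumes "open \<Omega>" and F: "integrable (lebesgue_on \<Omega>) F"
    and 0: "\<And>\<psi>. test_function \<Omega> \<psi> \<Longrightarrow> (\<integral>x. F x * \<psi> x \<partial>lebesgue_on \<Omega>) = 0"
    and sub: "cbox c d \<subseteq> \<Omega>"
  shows "(\<integral>x. F x * indicator (box c d) x \<partial>lebesgue_on \<Omega>) = 0"
proof -
  have [measurable]: "F \<in> borel_measurable (lebesgue_on \<Omega>)" using F by auto
  have [measurable]: "bump c d n \<in> borel_measurable (lebesgue_on \<Omega>)" for n
    by (intro smooth_measurable_lebesgue_on smooth_bump)
  have [measurable]: "(\<lambda>x. indicator (box c d) x :: real) \<in> borel_measurable (lebesgue_on \<Omega>)"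
    by (intro measurable_restrict_space1) (auto intro!: borel_measurable_indicator)
  have "(\<lambda>n. \<integral>x. F x * bump c d (real (Suc n)) x \<partial>lebesgue_on \<Omega>)
      \<longlonglongrightarrow> (\<integral>x. F x * indicator (box c d) x \<partial>lebesgue_on \<Omega>)"
  proof (rule integral_dominated_convergence)
    show "integrable (lebesgue_on \<Omega>) (\<lambda>x. \<bar>F x\<bar>)" using F by simp
    show "AE x in lebesgue_on \<Omega>. (\<lambda>n. F x * bump c d (real (Suc n)) x) \<longlonglongrightarrow> F x * indicator (box c d) x"
      by (intro AE_I2 tendsto_intros bump_tendsto)
    show "AE x in lebesgue_on \<Omega>. norm (F x * bump c d (real (Suc n)) x) \<le> \<bar>F x\<bar>" for n
      by (intro AE_I2) (simp add: abs_mult bump_bounds mult_left_le)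
  qed measurable
  moreover have "(\<integral>x. F x * bump c d (real (Suc n)) x \<partial>lebesgue_on \<Omega>) = 0" for n
    by (intro 0 test_function_bump sub) simp
  ultimately show ?thesis by (simp add: LIMSEQ_const_iff)
qed

text \<open>Boxes are an intersection-stable generator of the Borel sets. The sets over which
  \<open>h\<close> integrates to 0 are closed under complements, by \<open>tot\<close>, and under
  disjoint countable unions, so all Borel sets are among them.\<close>

lemma AE_lborel_eq_0I:
  fixes h :: "real^2 \<Rightarrow> real"
  assumes h: "integrable lborel h" and tot: "integral\<^sup>L lborel h = 0"
    and box: "\<And>c d. (LINT x:box c d|lborel. h x) = 0"
  shows "AE x in lborel. h x = 0"
proof (rule sigma_finite_measure.density_zero[OF lborel.sigma_finite_measure_axioms h])
  have si: "set_integrable lborel B h" if "B \<in> sets lborel" for B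
    using that h unfolding set_integrable_def by (rule integrable_mult_indicator)
  fix A :: "(real^2) set" assume "A \<in> sets lborel"
  then have A: "A \<in> sigma_sets UNIV (range (\<lambda>(a, b). box a b))"
    by (simp add: borel_eq_box)
  have "Int_stable (range (\<lambda>(a::real^2, b). box a b))"
    by (auto simp: Int_stable_def box_Int_box)
  moreover have "range (\<lambda>(a::real^2, b). box a b) \<subseteq> Pow UNIV" by simp
  ultimately show "(LINT x:A|lborel. h x) = 0"
    using A
  proof (induction rule: sigma_sets_induct_disjoint)
    case (basic A)
    then show ?case using box by auto
  next
    case empty
    then show ?case by (simp add: set_lebesgue_integral_def)
  next
    case (compl A)
    then have A: "A \<in> sets lborel" by (simp add: borel_eq_box)
    have "(LINT x:A \<union> (UNIV - A)|lborel. h x)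
        = (LINT x:A|lborel. h x) + (LINT x:UNIV - A|lborel. h x)"
      using A by (intro set_integral_Un si) auto
    then show ?case using compl tot by (simp add: set_lebesgue_integral_def)
  next
    case (union A)
    then have A: "A i \<in> sets lborel" for i by (simp add: borel_eq_box image_subset_iff)
    have "(LINT x:(\<Union>i. A i)|lborel. h x) = (\<Sum>i. LINT x:A i|lborel. h x)"
      using A union(1)
      by (intro lebesgue_integral_countable_add si sets.countable_UN) (auto simp: disjoint_family_on_def)
    then show ?case using union by simp
  qed
qed

text \<open>\<open>F\<close> is cut off to a box whose closure lies in the domain, so that integrals
  over arbitrary boxes are accessible. By the Lindelof property countably many such boxes cover the
  domain, and the exceptional null sets can be united.\<close>

lemma fundamental_lemma_variations:
  fixes F :: "real^2 \<Rightarrow> real"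
  assumes "open \<Omega>" and F: "integrable (lebesgue_on \<Omega>) F"
    and 0: "\<And>\<psi>. test_function \<Omega> \<psi> \<Longrightarrow> (\<integral>x. F x * \<psi> x \<partial>lebesgue_on \<Omega>) = 0"
  shows "AE x in lebesgue_on \<Omega>. F x = 0"
proof -
  have \<Omega>: "\<Omega> \<inter> space lebesgue \<in> sets lebesgue" using assms(1) by simp
  have on_box: "AE x in lebesgue. x \<in> box a b \<longrightarrow> F x = 0" if ab: "cbox a b \<subseteq> \<Omega>" for a b
  proof -
    define h where "h x = F x * indicator (box a b) x" for x
    have sub: "box a b \<subseteq> \<Omega>" using ab box_subset_cbox by blast
    have eq: "(\<integral>x. indicator (box c d) x *\<^sub>R h x \<partial>lebesgue)
        = (\<integral>x. F x * indicator (box c d \<inter> box a b) x \<partial>lebesgue_on \<Omega>)" for c d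
      unfolding integral_restrict_space[OF \<Omega>] h_def
      by (intro Bochner_Integration.integral_cong) (use sub in \<open>auto simp: indicator_def\<close>)
    have z: "(\<integral>x. indicator (box c d) x *\<^sub>R h x \<partial>lebesgue) = 0" for c d
    proof -
      obtain p q where pq: "box c d \<inter> box a b = box p q" by (rule that[OF box_Int_box])
      show ?thesis
      \<comment> \<open>An empty \<open>box p q\<close> may belong to a degenerate but nonempty
        \<open>cbox p q\<close> outside the domain; the inclusion of closed boxes is available only
        in the other case.\<close>
      proof (cases "box p q = {}")
        case True
        then show ?thesis unfolding eq pq by simp
      next
        case False
        have "box p q \<subseteq> box a b" using pq by blast
        then have "cbox p q \<subseteq> cbox a b"
          using closure_mono[of "box p q" "box a b"] False box_subset_cbox[of a b]
          by (metis closure_box closure_minimal closed_cbox order_trans)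
        then show ?thesis
          unfolding eq pq using integral_box_eq_0[OF assms(1) F 0] ab by blast
      qed
    qed
    have intF: "integrable lebesgue (\<lambda>x. indicator \<Omega> x *\<^sub>R F x)"
      using F integrable_restrict_space[OF \<Omega>, of F] by simp
    have "integrable lebesgue (\<lambda>x. indicator (box a b) x *\<^sub>R (indicator \<Omega> x *\<^sub>R F x))"
      by (intro integrable_mult_indicator intF) simp
    moreover have "(\<lambda>x. indicator (box a b) x *\<^sub>R (indicator \<Omega> x *\<^sub>R F x)) = h"
      using sub by (auto simp: h_def indicator_def fun_eq_iff)
    ultimately have h: "integrable lebesgue h" by simp
    \<comment> \<open>\<open>AE_lborel_eq_0I\<close> works with Borel functions, whereas
      \<open>h\<close> is only Lebesgue measurable. Integrals and null sets are transferred to the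
      Borel representative \<open>h'\<close> through the completion.\<close>
    then obtain h' where h': "h' \<in> borel_measurable lborel" and ae: "AE x in lborel. h x = h' x"
      using completion_ex_borel_measurable_real[of h lborel] by auto
    have ae': "AE x in lebesgue. h x = h' x" using ae by (rule AE_completion)
    have m': "h' \<in> borel_measurable lebesgue" using h' by (simp add: measurable_completion)
    have h'l: "integrable lebesgue h'"
      using h integrable_cong_AE[OF _ m' ae'] by auto
    then have h'i: "integrable lborel h'" using h' by (simp add: integrable_completion)
    have hm: "h \<in> borel_measurable lebesgue" using h by auto
    have zz: "(LINT x:box c d|lborel. h' x) = 0" for c d
    proof -
      have m: "(\<lambda>x. indicator (box c d) x *\<^sub>R h' x) \<in> borel_measurable lborel"
        using h' by measurable
      have "(LINT x:box c d|lborel. h' x) = (\<integral>x. indicator (box c d) x *\<^sub>R h' x \<partial>lebesgue)"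
        unfolding set_lebesgue_integral_def using integral_completion[OF m] by simp
      also have "\<dots> = (\<integral>x. indicator (box c d) x *\<^sub>R h x \<partial>lebesgue)"
        using ae' by (intro integral_cong_AE borel_measurable_scaleR borel_measurable_indicator hm m')
          (auto elim: eventually_mono)
      finally show ?thesis using z by simp
    qed
    have "integral\<^sup>L lborel h' = integral\<^sup>L lebesgue h'" using integral_completion[OF h'] by simp
    also have "\<dots> = integral\<^sup>L lebesgue h"
      using ae' h m' by (intro integral_cong_AE) (auto elim: eventually_mono)
    also have "\<dots> = (\<integral>x. indicator (box a b) x *\<^sub>R h x \<partial>lebesgue)"
      by (intro Bochner_Integration.integral_cong) (auto simp: h_def indicator_def)
    finally have "AE x in lborel. h' x = 0"
      using z h'i zz by (intro AE_lborel_eq_0I) auto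
    then have "AE x in lebesgue. h' x = 0" by (rule AE_completion)
    then show ?thesis using ae' by eventually_elim (auto simp: h_def)
  qed
  let ?D = "{box a b | a b. cbox a b \<subseteq> \<Omega>}"
  obtain D where D: "D \<subseteq> ?D" "countable D" "\<Union>D = \<Union>?D"
    using Lindelof[of ?D] by auto
  have D\<Omega>: "\<Omega> \<subseteq> \<Union>D"
  proof
    fix x assume "x \<in> \<Omega>"
    then obtain a b where "cbox a b \<subseteq> \<Omega>" "x \<in> box a b"
      using open_contains_cbox[OF assms(1)] by metis
    then show "x \<in> \<Union>D" unfolding D(3) by blast
  qed
  have "AE x in lebesgue. x \<in> X \<longrightarrow> F x = 0" if "X \<in> D" for X
    using D(1) that on_box by auto
  then have "AE x in lebesgue. \<forall>X\<in>D. x \<in> X \<longrightarrow> F x = 0"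
    by (subst AE_ball_countable[OF D(2)]) blast
  then have "AE x in lebesgue. x \<in> \<Omega> \<longrightarrow> F x = 0"
    by eventually_elim (use D\<Omega> in blast)
  then show ?thesis using AE_restrict_space_iff[OF \<Omega>] by simp
qed

section \<open>Weak gradients and strains on bounded open sets\<close>

lemma test_function_smooth: "test_function \<Omega> \<psi> \<Longrightarrow> smooth \<psi>"
  by (simp add: test_function_def smooth_def)

lemma H1_weak_gradient: "v \<in> H1 \<Omega> \<Longrightarrow> weak_gradient \<Omega> v (grad \<Omega> v)"
  using someI_ex[of "weak_gradient \<Omega> v"] by (auto simp: H1_def grad_def)

lemma weak_gradient_square_integrable: "weak_gradient \<Omega> v G \<Longrightarrow> square_integrable \<Omega> G"
  by (simp add: weak_gradient_def)

lemma weak_gradient_cong: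
  assumes "\<And>x. x \<in> \<Omega> \<Longrightarrow> v x = w x"
  shows "weak_gradient \<Omega> v G \<longleftrightarrow> weak_gradient \<Omega> w G"
proof -
  have "(\<integral>x. v x $ i * partial j \<psi> x \<partial>lebesgue_on \<Omega>) = (\<integral>x. w x $ i * partial j \<psi> x \<partial>lebesgue_on \<Omega>)"
    for i j \<psi>
    by (rule Bochner_Integration.integral_cong) (auto simp: assms)
  then show ?thesis unfolding weak_gradient_def by simp
qed

text \<open>Boundedness makes the measure finite, hence square integrable functions integrable;
  openness supplies enough test functions.\<close>

locale bounded_open_set =
  fixes \<Omega> :: "(real^2) set"
  assumes open_\<Omega>: "open \<Omega>" and bounded_\<Omega>: "bounded \<Omega>"
begin

lemma lmeasurable_\<Omega>: "\<Omega> \<in> lmeasurable"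
  using open_\<Omega> bounded_\<Omega> by (simp add: lmeasurable_open)

lemma integrable_component_mult:
  fixes f :: "real^2 \<Rightarrow> real"
  assumes f: "square_integrable \<Omega> f" and m: "m \<in> borel_measurable (lebesgue_on \<Omega>)"
    and "\<And>x. x \<in> \<Omega> \<Longrightarrow> \<bar>m x\<bar> \<le> B"
  shows "integrable (lebesgue_on \<Omega>) (\<lambda>x. f x * m x)"
  using assms square_integrable_imp_integrable[OF f lmeasurable_\<Omega>]
  by (intro integrable_mult_bounded[of _ f m B]) auto

lemma integrable_mult_test:
  fixes f :: "real^2 \<Rightarrow> real"
  assumes f: "square_integrable \<Omega> f" and \<psi>: "test_function \<Omega> \<psi>"
  shows "integrable (lebesgue_on \<Omega>) (\<lambda>x. f x * \<psi> x)"
    and "integrable (lebesgue_on \<Omega>) (\<lambda>x. f x * partial j \<psi> x)"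
proof -
  obtain B where "\<And>x. \<bar>\<psi> x\<bar> \<le> B" "\<And>x j. \<bar>partial j \<psi> x\<bar> \<le> B"
    using test_function_bounded[OF \<psi>] by blast
  then show "integrable (lebesgue_on \<Omega>) (\<lambda>x. f x * \<psi> x)"
    and "integrable (lebesgue_on \<Omega>) (\<lambda>x. f x * partial j \<psi> x)"
    using smooth_measurable_lebesgue_on smooth_partial test_function_smooth[OF \<psi>]
    by (auto intro!: integrable_component_mult[OF f, of _ B])
qed

lemma weak_gradient_unique:
  assumes G: "weak_gradient \<Omega> v G" and G': "weak_gradient \<Omega> v G'"
  shows "AE x in lebesgue_on \<Omega>. G x = G' x"
proof -
  have comp: "square_integrable \<Omega> (\<lambda>x. H x $ i $ j)" if "weak_gradient \<Omega> v H" for H i j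
    using that by (intro square_integrable_component weak_gradient_square_integrable)
  have "AE x in lebesgue_on \<Omega>. G x $ i $ j - G' x $ i $ j = 0" for i j
  proof (rule fundamental_lemma_variations[OF open_\<Omega>])
    show "integrable (lebesgue_on \<Omega>) (\<lambda>x. G x $ i $ j - G' x $ i $ j)"
      by (intro Bochner_Integration.integrable_diff comp[OF G] comp[OF G'] lmeasurable_\<Omega>
          square_integrable_imp_integrable)
    show "(\<integral>x. (G x $ i $ j - G' x $ i $ j) * \<psi> x \<partial>lebesgue_on \<Omega>) = 0"
      if \<psi>: "test_function \<Omega> \<psi>" for \<psi>
    proof -
      have "(\<integral>x. (G x $ i $ j - G' x $ i $ j) * \<psi> x \<partial>lebesgue_on \<Omega>)
          = (\<integral>x. G x $ i $ j * \<psi> x \<partial>lebesgue_on \<Omega>) - (\<integral>x. G' x $ i $ j * \<psi> x \<partial>lebesgue_on \<Omega>)"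
        by (simp add: left_diff_distrib integrable_mult_test[OF comp[OF G] \<psi>]
            integrable_mult_test[OF comp[OF G'] \<psi>])
      also have "\<dots> = 0"
      proof -
        have "(\<integral>x. v x $ i * partial j \<psi> x \<partial>lebesgue_on \<Omega>) = - (\<integral>x. H x $ i $ j * \<psi> x \<partial>lebesgue_on \<Omega>)"
          if "weak_gradient \<Omega> v H" for H
          using that \<psi> unfolding weak_gradient_def by blast
        from this[OF G] this[OF G'] show ?thesis by simp
      qed
      finally show ?thesis .
    qed
  qed
  then have "AE x in lebesgue_on \<Omega>. \<forall>i j. G x $ i $ j - G' x $ i $ j = 0"
    by (rule eventually_all_finite[OF eventually_all_finite])
  then show ?thesis by eventually_elim (simp add: vec_eq_iff)
qed

text \<open>Uniqueness makes the Hilbert choice harmless: \<open>grad\<close> is computed by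
  exhibiting any weak gradient.\<close>

lemma grad_AE_eq:
  assumes "weak_gradient \<Omega> v G"
  shows "AE x in lebesgue_on \<Omega>. grad \<Omega> v x = G x"
  using weak_gradient_unique[OF someI[of "weak_gradient \<Omega> v", OF assms] assms]
  by (simp add: grad_def)

text \<open>The single form \<open>v + t *\<^sub>R w\<close>, kept in all later linearity lemmas,
  covers sums (t = 1), the error (t = -1) and the shifts by multiples of the error.\<close>

lemma weak_gradient_add_scaleR:
  assumes v: "square_integrable \<Omega> v" and w: "square_integrable \<Omega> w"
    and G: "weak_gradient \<Omega> v G" and G': "weak_gradient \<Omega> w G'"
  shows "weak_gradient \<Omega> (\<lambda>x. v x + t *\<^sub>R w x) (\<lambda>x. G x + t *\<^sub>R G' x)"
  unfolding weak_gradient_def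
proof (intro conjI allI impI)
  note sG = weak_gradient_square_integrable[OF G] and sG' = weak_gradient_square_integrable[OF G']
  show "square_integrable \<Omega> (\<lambda>x. G x + t *\<^sub>R G' x)"
    by (intro square_integrable_add square_integrable_scaleR sG sG')
  fix \<psi> i j assume \<psi>: "test_function \<Omega> \<psi>"
  note I = integrable_mult_test[OF square_integrable_component \<psi>]
  have "(\<integral>x. (v x + t *\<^sub>R w x) $ i * partial j \<psi> x \<partial>lebesgue_on \<Omega>)
      = (\<integral>x. v x $ i * partial j \<psi> x + t * (w x $ i * partial j \<psi> x) \<partial>lebesgue_on \<Omega>)"
    by (simp add: algebra_simps)
  also have "\<dots> = (\<integral>x. v x $ i * partial j \<psi> x \<partial>lebesgue_on \<Omega>)
      + t * (\<integral>x. w x $ i * partial j \<psi> x \<partial>lebesgue_on \<Omega>)"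
    using I(2)[OF v] I(2)[OF w] by simp
  also have "\<dots> = - ((\<integral>x. G x $ i $ j * \<psi> x \<partial>lebesgue_on \<Omega>)
      + t * (\<integral>x. G' x $ i $ j * \<psi> x \<partial>lebesgue_on \<Omega>))"
    using G G' \<psi> unfolding weak_gradient_def by simp
  also have "\<dots> = - (\<integral>x. G x $ i $ j * \<psi> x + t * (G' x $ i $ j * \<psi> x) \<partial>lebesgue_on \<Omega>)"
    using integrable_mult_test(1)[OF square_integrable_component[OF square_integrable_component[OF sG]] \<psi>]
      integrable_mult_test(1)[OF square_integrable_component[OF square_integrable_component[OF sG']] \<psi>]
    by simp
  also have "\<dots> = - (\<integral>x. (G x + t *\<^sub>R G' x) $ i $ j * \<psi> x \<partial>lebesgue_on \<Omega>)"
    by (simp add: algebra_simps)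
  finally show "(\<integral>x. (v x + t *\<^sub>R w x) $ i * partial j \<psi> x \<partial>lebesgue_on \<Omega>)
      = - (\<integral>x. (G x + t *\<^sub>R G' x) $ i $ j * \<psi> x \<partial>lebesgue_on \<Omega>)" .
qed

lemma H1_square_integrable: "v \<in> H1 \<Omega> \<Longrightarrow> square_integrable \<Omega> v"
  by (simp add: H1_def)

lemma H1_grad_square_integrable: "v \<in> H1 \<Omega> \<Longrightarrow> square_integrable \<Omega> (grad \<Omega> v)"
  using H1_weak_gradient weak_gradient_square_integrable by blast

lemma H1_add_scaleR:
  assumes "v \<in> H1 \<Omega>" "w \<in> H1 \<Omega>"
  shows "(\<lambda>x. v x + t *\<^sub>R w x) \<in> H1 \<Omega>"
  using assms weak_gradient_add_scaleR[OF _ _ H1_weak_gradient H1_weak_gradient, of v w t]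
    square_integrable_add[OF _ square_integrable_scaleR, of \<Omega> v w t]
  unfolding H1_def by blast

lemma grad_add_scaleR:
  assumes "v \<in> H1 \<Omega>" "w \<in> H1 \<Omega>"
  shows "AE x in lebesgue_on \<Omega>. grad \<Omega> (\<lambda>x. v x + t *\<^sub>R w x) x = grad \<Omega> v x + t *\<^sub>R grad \<Omega> w x"
  using assms by (intro grad_AE_eq weak_gradient_add_scaleR H1_weak_gradient H1_square_integrable)

lemma strain_square_integrable:
  assumes "v \<in> H1 \<Omega>"
  shows "square_integrable \<Omega> (strain \<Omega> v)"
proof -
  have "linear (\<lambda>A :: real^2^2. (1/2) *\<^sub>R (A + transpose A))"
    by (rule linearI) (auto simp: vec_eq_iff transpose_def algebra_simps)
  from square_integrable_linear[OF this H1_grad_square_integrable[OF assms]]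
  show ?thesis unfolding strain_def[abs_def] .
qed

lemma strain_add_scaleR:
  assumes "v \<in> H1 \<Omega>" "w \<in> H1 \<Omega>"
  shows "AE x in lebesgue_on \<Omega>. strain \<Omega> (\<lambda>x. v x + t *\<^sub>R w x) x = strain \<Omega> v x + t *\<^sub>R strain \<Omega> w x"
  using grad_add_scaleR[OF assms, of t]
  by eventually_elim (auto simp: strain_def vec_eq_iff transpose_def algebra_simps)

lemma zero_in_H1: "(\<lambda>x. 0) \<in> H1 \<Omega>"
proof -
  have "weak_gradient \<Omega> (\<lambda>x. 0) (\<lambda>x. 0)" "square_integrable \<Omega> (\<lambda>x. 0 :: real^2)"
    by (auto simp: weak_gradient_def square_integrable_def)
  then show ?thesis by (auto simp: H1_def)
qed

lemma strain_zero: "AE x in lebesgue_on \<Omega>. strain \<Omega> (\<lambda>x. 0) x = 0"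
proof -
  have "weak_gradient \<Omega> (\<lambda>x. 0) (\<lambda>x. 0)"
    by (auto simp: weak_gradient_def square_integrable_def)
  from grad_AE_eq[OF this] show ?thesis
    by eventually_elim (simp add: strain_def transpose_def vec_eq_iff)
qed

text \<open>Membership and strain go through one induction, since the strain is additive only once
  the partial sum is known to lie in \<open>H1\<close>.\<close>

lemma H1_sum_strain:
  assumes "finite N" "\<And>z. z \<in> N \<Longrightarrow> v z \<in> H1 \<Omega>"
  shows "(\<lambda>x. \<Sum>z\<in>N. v z x) \<in> H1 \<Omega> \<and>
    (AE x in lebesgue_on \<Omega>. strain \<Omega> (\<lambda>x. \<Sum>z\<in>N. v z x) x = (\<Sum>z\<in>N. strain \<Omega> (v z) x))"
  using assms
proof (induction N rule: finite_induct)
  case empty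
  then show ?case using zero_in_H1 strain_zero by simp
next
  case (insert z N)
  have eq: "(\<lambda>x. \<Sum>y\<in>insert z N. v y x) = (\<lambda>x. v z x + 1 *\<^sub>R (\<Sum>y\<in>N. v y x))"
    using insert by auto
  have vz: "v z \<in> H1 \<Omega>" and N: "(\<lambda>x. \<Sum>y\<in>N. v y x) \<in> H1 \<Omega>"
    and ae: "AE x in lebesgue_on \<Omega>. strain \<Omega> (\<lambda>x. \<Sum>y\<in>N. v y x) x = (\<Sum>y\<in>N. strain \<Omega> (v y) x)"
    using insert by auto
  have "AE x in lebesgue_on \<Omega>. strain \<Omega> (\<lambda>x. \<Sum>y\<in>insert z N. v y x) x
      = (\<Sum>y\<in>insert z N. strain \<Omega> (v y) x)"
    unfolding eq using ae strain_add_scaleR[OF vz N, of 1]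
    by eventually_elim (use insert in auto)
  then show ?case unfolding eq using H1_add_scaleR[OF vz N, of 1] by simp
qed

text \<open>The gradients agree everywhere, not just almost everywhere: the predicates
  \<open>weak_gradient \<Omega> v\<close> and \<open>weak_gradient \<Omega> w\<close> coincide, so
  the choice returns the same witness.\<close>

lemma H1_cong:
  assumes "\<And>x. x \<in> \<Omega> \<Longrightarrow> v x = w x" "v \<in> H1 \<Omega>"
  shows "w \<in> H1 \<Omega> \<and> grad \<Omega> w = grad \<Omega> v"
proof -
  have *: "weak_gradient \<Omega> v = weak_gradient \<Omega> w"
    by (rule ext, rule weak_gradient_cong) (rule assms(1))
  have "square_integrable \<Omega> w"
  proof (rule square_integrable_dominated[of _ _ v 1])
    have "v \<in> borel_measurable (lebesgue_on \<Omega>)"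
      using square_integrable_measurable[OF H1_square_integrable[OF assms(2)]] .
    then show "w \<in> borel_measurable (lebesgue_on \<Omega>)"
      using measurable_cong[of "lebesgue_on \<Omega>" v w borel] assms(1) by simp
  qed (use assms H1_square_integrable in auto)
  then show ?thesis
    using assms(2) * by (simp add: grad_def H1_def)
qed

end

subsection \<open>Mollification\<close>

text \<open>The class for the coinduction lets the kernel vary and fixes \<open>g\<close>:
  differentiation under the integral puts every derivative on the kernel, so continuity of
  \<open>g\<close> is enough.\<close>

lemma smooth_convolution:
  fixes a b :: "real^2"
  assumes "smooth \<rho>" and g: "continuous_on UNIV g"
  shows "smooth (\<lambda>x. integral (cbox a b) (\<lambda>t. g t * \<rho> (x - t)))"
proof (rule smooth_coinduct[where P = "\<lambda>f. \<exists>\<rho>. smooth \<rho> \<and> f = (\<lambda>x. integral (cbox a b) (\<lambda>t. g t * \<rho> (x - t)))"])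
  show "\<exists>\<rho>'. smooth \<rho>' \<and> (\<lambda>x. integral (cbox a b) (\<lambda>t. g t * \<rho> (x - t)))
      = (\<lambda>x. integral (cbox a b) (\<lambda>t. g t * \<rho>' (x - t)))"
    using assms(1) by blast
next
  fix f assume "\<exists>\<rho>. smooth \<rho> \<and> f = (\<lambda>x. integral (cbox a b) (\<lambda>t. g t * \<rho> (x - t)))"
  then obtain \<rho> where \<rho>: "smooth \<rho>" and f: "f = (\<lambda>x. integral (cbox a b) (\<lambda>t. g t * \<rho> (x - t)))"
    by blast
  \<comment> \<open>The Leibniz rule wants the derivative as a continuous family of bounded linear
    maps; \<open>fx\<close> assembles it from the coordinate functionals \<open>E j\<close>.\<close>
  define E :: "2 \<Rightarrow> (real^2) \<Rightarrow>\<^sub>L real" where "E j = Blinfun (\<lambda>h. h $ j)" for j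
  have E: "blinfun_apply (E j) h = h $ j" for j h
    unfolding E_def using bounded_linear_Blinfun_apply[OF bounded_linear_vec_nth] by metis
  define fx where "fx x t = (\<Sum>j\<in>UNIV. (g t * partial j \<rho> (x - t)) *\<^sub>R E j)" for x t
  have fx: "blinfun_apply (fx x t) h = g t * (\<Sum>j\<in>UNIV. h $ j * partial j \<rho> (x - t))" for x t h
    unfolding fx_def by (simp add: blinfun.sum_left blinfun.scaleR_left E sum_distrib_left mult_ac)
  have c\<rho>: "continuous_on S (\<lambda>x. \<sigma> (h x))" if "smooth \<sigma>" "continuous_on S h" for \<sigma> S
    and h :: "'b::topological_space \<Rightarrow> real^2"
    using continuous_on_compose2[OF smooth_continuous[OF that(1), of UNIV] that(2)] by auto
  have cg: "continuous_on S (\<lambda>x. g (h x))" if "continuous_on S h" for S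
    and h :: "'b::topological_space \<Rightarrow> real^2"
    using continuous_on_compose2[OF g that] by auto
  have cfx: "continuous_on S (\<lambda>(x, t). fx x t)" for S
    unfolding fx_def case_prod_beta
    by (intro continuous_intros c\<rho> cg smooth_partial \<rho>)
  have cfx1: "continuous_on S (fx x)" for S x
    unfolding fx_def by (intro continuous_intros c\<rho> cg smooth_partial \<rho>)
  have D: "(f has_derivative blinfun_apply (integral (cbox a b) (fx x))) (at x)" for x
    unfolding f
  proof (rule leibniz_rule[where U = UNIV, simplified])
    show "((\<lambda>x. g t * \<rho> (x - t)) has_derivative blinfun_apply (fx x t)) (at x)" for x t
      unfolding fx[abs_def]
      by (intro has_derivative_mult_right has_derivative_compose[OF _ smooth_has_derivative[OF \<rho>], of "\<lambda>x. x - t" "\<lambda>h. h"])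
         (auto intro!: derivative_eq_intros)
    show "(\<lambda>t. g t * \<rho> (x - t)) integrable_on cbox a b" for x
      by (intro integrable_continuous continuous_intros c\<rho> cg \<rho>)
  qed (rule cfx)
  have "partial j f = (\<lambda>x. integral (cbox a b) (\<lambda>t. g t * partial j \<rho> (x - t)))" for j
  proof
    fix x
    have "partial j f x = blinfun_apply (integral (cbox a b) (fx x)) (axis j 1)"
      by (rule partial_eqI[OF D])
    also have "\<dots> = integral (cbox a b) (\<lambda>t. blinfun_apply (fx x t) (axis j 1))"
      using integral_linear[OF integrable_continuous[OF cfx1] blinfun.bounded_linear_left]
      by (simp add: o_def)
    also have "\<dots> = integral (cbox a b) (\<lambda>t. g t * partial j \<rho> (x - t))"
      unfolding fx by (simp add: axis_def if_distrib[of "\<lambda>c. c * _"] sum.If_cases cong: if_cong)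
    finally show "partial j f x = integral (cbox a b) (\<lambda>t. g t * partial j \<rho> (x - t))" .
  qed
  then show "f differentiable_on UNIV \<and> (\<forall>j. \<exists>\<rho>. smooth \<rho> \<and>
      partial j f = (\<lambda>x. integral (cbox a b) (\<lambda>t. g t * \<rho> (x - t))))"
    using D smooth_partial[OF \<rho>] unfolding differentiable_on_def differentiable_def by blast
qed

text \<open>The scaling factor -1 enters the density as its absolute value squared, which is
  1.\<close>

lemma lborel_integral_reflect:
  fixes f :: "real^2 \<Rightarrow> real"
  assumes "f \<in> borel_measurable borel"
  shows "(\<integral>t. f t \<partial>lborel) = (\<integral>y. f (x - y) \<partial>lborel)"
proof -
  have "lborel = distr lborel borel (\<lambda>y. x - y)"
    using lborel_affine[of "-1" x] by (simp add: density_1)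
  then have "(\<integral>t. f t \<partial>lborel) = (\<integral>t. f t \<partial>distr lborel borel (\<lambda>y. x - y))" by simp
  also have "\<dots> = (\<integral>y. f (x - y) \<partial>lborel)"
    using assms by (intro integral_distr) auto
  finally show ?thesis .
qed

text \<open>Not normalised; \<open>mollify\<close> divides by the integral. A square is used instead
  of a disc so that the product construction \<open>bump\<close> can be reused.\<close>

definition bump_kernel :: "real \<Rightarrow> real^2 \<Rightarrow> real" where
  "bump_kernel \<delta> = bump (vec (- \<delta>)) (vec \<delta>) 1"

lemma smooth_bump_kernel: "smooth (bump_kernel \<delta>)"
  by (simp add: bump_kernel_def smooth_bump)

lemma bump_kernel_nonneg: "0 \<le> bump_kernel \<delta> x"
  by (simp add: bump_kernel_def bump_bounds)

lemma bump_kernel_eq_0: "x \<notin> box (vec (- \<delta>)) (vec \<delta>) \<Longrightarrow> bump_kernel \<delta> x = 0"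
  by (simp add: bump_kernel_def bump_eq_0)

lemma integrable_mult_bump_kernel:
  fixes h :: "real^2 \<Rightarrow> real"
  assumes "continuous_on UNIV h"
  shows "integrable lborel (\<lambda>y. h y * bump_kernel \<delta> y)"
proof -
  have "integrable lborel (\<lambda>y. indicator (cbox (vec (- \<delta>)) (vec \<delta>)) y *\<^sub>R (h y * bump_kernel \<delta> y))"
    by (intro borel_integrable_compact continuous_on_mult smooth_continuous smooth_bump_kernel
        continuous_on_subset[OF assms]) auto
  moreover have "indicator (cbox (vec (- \<delta>)) (vec \<delta>)) y *\<^sub>R (h y * bump_kernel \<delta> y) = h y * bump_kernel \<delta> y" for y
    using bump_kernel_eq_0[of y \<delta>] box_subset_cbox[of "vec (- \<delta>)" "vec \<delta> :: real^2"]
    by (auto simp: indicator_def)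
  ultimately show ?thesis by (simp del: real_scaleR_def)
qed

text \<open>Otherwise the nonnegative kernel would vanish almost everywhere, and the nonempty open
  square on which it is positive would be a null set.\<close>

lemma bump_kernel_integral_pos:
  assumes "\<delta> > 0"
  shows "(\<integral>y. bump_kernel \<delta> y \<partial>lborel) > 0"
proof -
  have I: "integrable lborel (bump_kernel \<delta>)"
    using integrable_mult_bump_kernel[of "\<lambda>_. 1" \<delta>] by simp
  have "(\<integral>y. bump_kernel \<delta> y \<partial>lborel) \<noteq> 0"
  proof
    assume "(\<integral>y. bump_kernel \<delta> y \<partial>lborel) = 0"
    then have "AE y in lborel. bump_kernel \<delta> y = 0"
      using integral_nonneg_eq_0_iff_AE[OF I] bump_kernel_nonneg by simp
    then have "AE y in lborel. y \<notin> box (vec (- \<delta>)) (vec \<delta> :: real^2)"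
      by eventually_elim (metis bump_pos bump_kernel_def less_irrefl zero_less_one)
    then have "AE y in lebesgue. y \<notin> box (vec (- \<delta>)) (vec \<delta> :: real^2)"
      by (rule AE_completion)
    then have "negligible (box (vec (- \<delta>)) (vec \<delta> :: real^2))"
      by (simp add: negligible_iff_null_sets AE_iff_null_sets)
    moreover have "0 \<in> box (vec (- \<delta>)) (vec \<delta> :: real^2)"
      using assms by (simp add: mem_box_cart)
    ultimately show False
      using open_not_negligible[OF open_box] by blast
  qed
  moreover have "(\<integral>y. bump_kernel \<delta> y \<partial>lborel) \<ge> 0" by (simp add: bump_kernel_nonneg)
  ultimately show ?thesis by linarith
qed

definition mollify :: "real^2 \<Rightarrow> real^2 \<Rightarrow> real \<Rightarrow> (real^2 \<Rightarrow> real) \<Rightarrow> real^2 \<Rightarrow> real" where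
  "mollify a b \<delta> g x =
     (1 / (\<integral>y. bump_kernel \<delta> y \<partial>lborel)) * integral (cbox a b) (\<lambda>t. g t * bump_kernel \<delta> (x - t))"

lemma smooth_mollify: "continuous_on UNIV g \<Longrightarrow> smooth (mollify a b \<delta> g)"
  unfolding mollify_def[abs_def]
  by (intro smooth_mult smooth_const smooth_convolution smooth_bump_kernel)

text \<open>The window \<open>cbox a b\<close> keeps the parameter integral over a compact set; it is invisible at
  points whose \<open>\<delta>\<close>-neighbourhood it contains.\<close>

lemma mollify_eq:
  assumes g: "continuous_on UNIV g"
    and win: "\<And>y. y \<in> box (vec (- \<delta>)) (vec \<delta>) \<Longrightarrow> x - y \<in> cbox a b"
  shows "mollify a b \<delta> g x = (\<integral>y. g (x - y) * bump_kernel \<delta> y \<partial>lborel) / (\<integral>y. bump_kernel \<delta> y \<partial>lborel)"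
proof -
  let ?f = "\<lambda>t. g t * bump_kernel \<delta> (x - t)"
  have cont: "continuous_on S ?f" for S
    by (intro continuous_on_mult continuous_on_subset[OF g] continuous_intros subset_UNIV
        continuous_on_compose2[OF smooth_continuous[OF smooth_bump_kernel, of UNIV]])
  have "set_integrable lborel (cbox a b) ?f"
    unfolding set_integrable_def by (intro borel_integrable_compact cont) auto
  then have "integral (cbox a b) ?f = (LINT t:cbox a b|lborel. ?f t)"
    by (rule set_borel_integral_eq_integral(2)[symmetric])
  also have "\<dots> = (\<integral>t. ?f t \<partial>lborel)"
    unfolding set_lebesgue_integral_def
  proof (intro Bochner_Integration.integral_cong refl)
    show "indicator (cbox a b) t *\<^sub>R ?f t = ?f t" for t
      using bump_kernel_eq_0[of "x - t" \<delta>] win[of "x - t"] by (auto simp: indicator_def)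
  qed
  also have "\<dots> = (\<integral>y. ?f (x - y) \<partial>lborel)"
    using cont by (intro lborel_integral_reflect borel_measurable_continuous_onI)
  finally show ?thesis by (simp add: mollify_def)
qed

text \<open>A mean with nonnegative weights lies between the bounds of what is averaged, and points
  off the square have weight 0. It serves both for values and for increments of the mollified
  function.\<close>

lemma bump_kernel_average_bounds:
  assumes "\<delta> > 0" and h: "continuous_on UNIV h"
    and le: "\<And>y. y \<in> box (vec (- \<delta>)) (vec \<delta>) \<Longrightarrow> \<alpha> \<le> h y \<and> h y \<le> \<beta>"
  shows "\<alpha> \<le> (\<integral>y. h y * bump_kernel \<delta> y \<partial>lborel) / (\<integral>y. bump_kernel \<delta> y \<partial>lborel)"
    and "(\<integral>y. h y * bump_kernel \<delta> y \<partial>lborel) / (\<integral>y. bump_kernel \<delta> y \<partial>lborel) \<le> \<beta>"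
proof -
  have I: "integrable lborel (\<lambda>y. c * bump_kernel \<delta> y)" for c
    by (intro integrable_mult_bump_kernel continuous_on_const)
  have "(\<integral>y. \<alpha> * bump_kernel \<delta> y \<partial>lborel) \<le> (\<integral>y. h y * bump_kernel \<delta> y \<partial>lborel)"
    using le bump_kernel_eq_0[of _ \<delta>] bump_kernel_nonneg[of \<delta>]
    by (intro integral_mono I integrable_mult_bump_kernel h)
       (metis mult_right_mono mult_zero_right order_refl)
  then show "\<alpha> \<le> (\<integral>y. h y * bump_kernel \<delta> y \<partial>lborel) / (\<integral>y. bump_kernel \<delta> y \<partial>lborel)"
    using bump_kernel_integral_pos[OF assms(1)] by (simp add: pos_le_divide_eq)
  have "(\<integral>y. h y * bump_kernel \<delta> y \<partial>lborel) \<le> (\<integral>y. \<beta> * bump_kernel \<delta> y \<partial>lborel)"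
    using le bump_kernel_eq_0[of _ \<delta>] bump_kernel_nonneg[of \<delta>]
    by (intro integral_mono I integrable_mult_bump_kernel h)
       (metis mult_right_mono mult_zero_right order_refl)
  then show "(\<integral>y. h y * bump_kernel \<delta> y \<partial>lborel) / (\<integral>y. bump_kernel \<delta> y \<partial>lborel) \<le> \<beta>"
    using bump_kernel_integral_pos[OF assms(1)] by (simp add: pos_divide_le_eq)
qed

text \<open>An increment of the mollified function is the average of the increments of
  \<open>g\<close> at shifted points and inherits their bounds. No derivative of \<open>g\<close>
  occurs, and \<open>\<alpha> = \<beta>\<close> yields an exact value.\<close>

lemma partial_mollify_bounds:
  assumes "\<delta> > 0" "\<tau> > 0" and g: "continuous_on UNIV g"
    and win: "\<And>y t. y \<in> box (vec (- \<delta>)) (vec \<delta>) \<Longrightarrow> 0 \<le> t \<Longrightarrow> t < \<tau> \<Longrightarrow> x + t *\<^sub>R axis j 1 - y \<in> cbox a b"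
    and le: "\<And>y t. y \<in> box (vec (- \<delta>)) (vec \<delta>) \<Longrightarrow> 0 < t \<Longrightarrow> t < \<tau> \<Longrightarrow>
      t * \<alpha> \<le> g (x + t *\<^sub>R axis j 1 - y) - g (x - y) \<and> g (x + t *\<^sub>R axis j 1 - y) - g (x - y) \<le> t * \<beta>"
  shows "\<alpha> \<le> partial j (mollify a b \<delta> g) x \<and> partial j (mollify a b \<delta> g) x \<le> \<beta>"
proof -
  let ?p = "mollify a b \<delta> g" and ?e = "axis j 1 :: real^2"
  let ?c = "\<integral>y. bump_kernel \<delta> y \<partial>lborel"
  have cg: "continuous_on S (\<lambda>y. g (z - y))" for z S
    by (intro continuous_on_compose2[OF g] continuous_intros subset_UNIV)
  have diff: "?p (x + t *\<^sub>R ?e) - ?p x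
      = (\<integral>y. (g (x + t *\<^sub>R ?e - y) - g (x - y)) * bump_kernel \<delta> y \<partial>lborel) / ?c"
    if "0 < t" "t < \<tau>" for t
  proof -
    have "?p (x + t *\<^sub>R ?e) = (\<integral>y. g (x + t *\<^sub>R ?e - y) * bump_kernel \<delta> y \<partial>lborel) / ?c"
      by (rule mollify_eq[OF g]) (use win that in auto)
    moreover have "?p x = (\<integral>y. g (x - y) * bump_kernel \<delta> y \<partial>lborel) / ?c"
      by (rule mollify_eq[OF g]) (use win[of _ 0] assms(2) in auto)
    ultimately show ?thesis
      by (simp add: left_diff_distrib integrable_mult_bump_kernel cg diff_divide_distrib)
  qed
  have q: "\<alpha> \<le> (?p (x + t *\<^sub>R ?e) - ?p x) / t \<and> (?p (x + t *\<^sub>R ?e) - ?p x) / t \<le> \<beta>"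
    if "0 < t" "t < \<tau>" for t
  proof -
    have "continuous_on UNIV (\<lambda>y. g (x + t *\<^sub>R ?e - y) - g (x - y))"
      by (intro continuous_on_diff cg)
    from bump_kernel_average_bounds[OF assms(1) this le[OF _ that]]
    have "t * \<alpha> \<le> ?p (x + t *\<^sub>R ?e) - ?p x" "?p (x + t *\<^sub>R ?e) - ?p x \<le> t * \<beta>"
      unfolding diff[OF that] by blast+
    then show ?thesis using that by (simp add: pos_le_divide_eq pos_divide_le_eq mult.commute)
  qed
  have "((\<lambda>t. ?p (x + t *\<^sub>R ?e)) has_derivative (\<lambda>t. frechet_derivative ?p (at x) (t *\<^sub>R ?e))) (at 0)"
    using frechet_derivative_works[THEN iffD1, OF smooth_differentiable[OF smooth_mollify[OF g]], of a b \<delta> x]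
    by (intro has_derivative_compose[of "\<lambda>t. x + t *\<^sub>R ?e" "\<lambda>t. t *\<^sub>R ?e" 0 UNIV ?p])
       (auto intro!: derivative_eq_intros)
  moreover have "frechet_derivative ?p (at x) (t *\<^sub>R ?e) = t * partial j ?p x" for t
    using frechet_derivative_works[THEN iffD1, OF smooth_differentiable[OF smooth_mollify[OF g]], of a b \<delta> x]
    by (simp add: partial_def linear_cmul has_derivative_linear)
  ultimately have "((\<lambda>t. ?p (x + t *\<^sub>R ?e)) has_real_derivative partial j ?p x) (at 0)"
    by (simp add: has_field_derivative_def mult_commute_abs)
  \<comment> \<open>The bounds concern \<open>t > 0\<close> only; since the derivative exists, the
    right-hand limit determines it.\<close>
  then have "((\<lambda>t. (?p (x + t *\<^sub>R ?e) - ?p x) / t) \<longlongrightarrow> partial j ?p x) (at_right 0)"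
    unfolding DERIV_def by (auto intro: filterlim_mono[OF _ order_refl] at_le)
  moreover have "\<forall>\<^sub>F t in at_right 0. \<alpha> \<le> (?p (x + t *\<^sub>R ?e) - ?p x) / t \<and> (?p (x + t *\<^sub>R ?e) - ?p x) / t \<le> \<beta>"
    unfolding eventually_at_right_field using q assms(2) by blast
  ultimately show ?thesis
    using tendsto_lowerbound[of "\<lambda>t. (?p (x + t *\<^sub>R ?e) - ?p x) / t" _ "at_right 0" \<alpha>]
      tendsto_upperbound[of "\<lambda>t. (?p (x + t *\<^sub>R ?e) - ?p x) / t" _ "at_right 0" \<beta>]
    by (simp add: eventually_conj_iff)
qed

subsection \<open>Products with \<open>H\<^sup>1\<close> functions\<close>

lemma norm_vec_square: "(norm x)\<^sup>2 = (\<Sum>i\<in>UNIV. (norm (x $ i))\<^sup>2)"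
  for x :: "'b::real_normed_vector^'n"
  by (simp add: norm_vec_def L2_set_def sum_nonneg)

lemma borel_measurable_vec:
  fixes f :: "'a \<Rightarrow> 'b::euclidean_space^'n"
  assumes "\<And>i. (\<lambda>x. f x $ i) \<in> borel_measurable M"
  shows "f \<in> borel_measurable M"
  using assms by (subst borel_measurable_euclidean_space) (auto simp: Basis_vec_def inner_axis)

lemma square_integrable_vec:
  fixes f :: "'a::euclidean_space \<Rightarrow> 'b::euclidean_space^'n"
  assumes "\<And>i. square_integrable S (\<lambda>x. f x $ i)"
  shows "square_integrable S f"
  using assms unfolding square_integrable_def norm_vec_square
  by (auto intro: borel_measurable_vec)

context bounded_open_set
begin

lemma square_integrable_mult_bounded:
  fixes m :: "real^2 \<Rightarrow> real" and f :: "real^2 \<Rightarrow> 'b::euclidean_space"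
  assumes f: "square_integrable \<Omega> f" and m: "m \<in> borel_measurable (lebesgue_on \<Omega>)"
    and B: "\<And>x. x \<in> \<Omega> \<Longrightarrow> \<bar>m x\<bar> \<le> B"
  shows "square_integrable \<Omega> (\<lambda>x. m x *\<^sub>R f x)"
proof (rule square_integrable_dominated[OF _ f, of _ B])
  show "(\<lambda>x. m x *\<^sub>R f x) \<in> borel_measurable (lebesgue_on \<Omega>)"
    using m square_integrable_measurable[OF f] by (rule borel_measurable_scaleR)
  show "norm (m x *\<^sub>R f x) \<le> B * norm (f x)" if "x \<in> \<Omega>" for x
    using B[OF that] by (simp add: mult_right_mono)
qed

text \<open>The product rule is obtained by testing with \<open>p n * \<psi>\<close> and passing to the limit.\<close>

lemma weak_gradient_mult_limit:
  fixes p :: "nat \<Rightarrow> real^2 \<Rightarrow> real" and \<phi> :: "real^2 \<Rightarrow> real" and D :: "2 \<Rightarrow> real^2 \<Rightarrow> real"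
  assumes sm: "\<And>n. smooth (p n)"
    and lim: "\<And>x. x \<in> \<Omega> \<Longrightarrow> (\<lambda>n. p n x) \<longlonglongrightarrow> \<phi> x"
    and Dlim: "\<And>j. AE x in lebesgue_on \<Omega>. (\<lambda>n. partial j (p n) x) \<longlonglongrightarrow> D j x"
    and bd: "\<And>K. compact K \<Longrightarrow> K \<subseteq> \<Omega> \<Longrightarrow>
      \<exists>N. \<forall>n\<ge>N. \<forall>x\<in>K. \<bar>p n x\<bar> \<le> B \<and> (\<forall>j. \<bar>partial j (p n) x\<bar> \<le> B)"
    and \<phi>: "\<phi> \<in> borel_measurable (lebesgue_on \<Omega>)" "\<And>x. x \<in> \<Omega> \<Longrightarrow> \<bar>\<phi> x\<bar> \<le> B"
    and D: "\<And>j. D j \<in> borel_measurable (lebesgue_on \<Omega>)" "\<And>j x. x \<in> \<Omega> \<Longrightarrow> \<bar>D j x\<bar> \<le> B"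
    and v: "square_integrable \<Omega> v" and G: "weak_gradient \<Omega> v G"
  shows "weak_gradient \<Omega> (\<lambda>x. \<phi> x *\<^sub>R v x) (\<lambda>x. \<chi> i j. \<phi> x * G x $ i $ j + D j x * v x $ i)"
  unfolding weak_gradient_def
proof (intro conjI allI impI)
  have sv: "square_integrable \<Omega> (\<lambda>x. v x $ i)" for i
    by (intro square_integrable_component v)
  have sG: "square_integrable \<Omega> (\<lambda>x. G x $ i $ j)" for i j
    by (intro square_integrable_component weak_gradient_square_integrable[OF G])
  note s\<phi>G = square_integrable_mult_bounded[OF sG \<phi>, unfolded real_scaleR_def]
  note sDv = square_integrable_mult_bounded[OF sv D, unfolded real_scaleR_def]
  note s\<phi>v = square_integrable_mult_bounded[OF sv \<phi>, unfolded real_scaleR_def]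
  show "square_integrable \<Omega> (\<lambda>x. \<chi> i j. \<phi> x * G x $ i $ j + D j x * v x $ i)"
  proof (rule square_integrable_vec, rule square_integrable_vec)
    fix i j
    show "square_integrable \<Omega> (\<lambda>x. (\<chi> i j. \<phi> x * G x $ i $ j + D j x * v x $ i) $ i $ j)"
      using square_integrable_add[OF s\<phi>G sDv] by simp
  qed
  fix \<psi> i j assume \<psi>: "test_function \<Omega> \<psi>"
  note sm\<psi> = test_function_smooth[OF \<psi>]
  obtain K where K: "compact K" "K \<subseteq> \<Omega>" and \<psi>0: "\<And>x. x \<notin> K \<Longrightarrow> \<psi> x = 0"
    and d\<psi>0: "\<And>x j. x \<notin> K \<Longrightarrow> partial j \<psi> x = 0"
    using test_function_support[OF \<psi>] by metis
  obtain C where C: "\<And>x. \<bar>\<psi> x\<bar> \<le> C" "\<And>x j. \<bar>partial j \<psi> x\<bar> \<le> C"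
    using test_function_bounded[OF \<psi>] by metis
  obtain N where N: "\<And>n x. n \<ge> N \<Longrightarrow> x \<in> K \<Longrightarrow> \<bar>p n x\<bar> \<le> B"
    "\<And>n x j. n \<ge> N \<Longrightarrow> x \<in> K \<Longrightarrow> \<bar>partial j (p n) x\<bar> \<le> B"
    using bd[OF K] by metis
  \<comment> \<open>The bounds on \<open>p n\<close> hold on \<open>K\<close> only from index
    \<open>N\<close> on; the shift makes them uniform, as dominated convergence requires.\<close>
  define q where "q n = p (n + N)" for n
  \<comment> \<open>Outside \<open>K\<close> the products are 0; writing
    \<open>\<bar>B\<bar>\<close> keeps the bound valid there whatever the sign of
    \<open>B\<close>.\<close>
  have q\<psi>: "\<bar>q n x * \<psi> x\<bar> \<le> \<bar>B\<bar> * C" "\<bar>q n x * partial j \<psi> x\<bar> \<le> \<bar>B\<bar> * C"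
    "\<bar>partial j (q n) x * \<psi> x\<bar> \<le> \<bar>B\<bar> * C" for n x
  proof -
    have "0 \<le> C" using C(1)[of x] by linarith
    moreover have "\<bar>q n x\<bar> \<le> \<bar>B\<bar>" "\<bar>partial j (q n) x\<bar> \<le> \<bar>B\<bar>" if "x \<in> K"
      using N(1)[of "n + N" x] N(2)[of "n + N" x j] that unfolding q_def by force+
    ultimately show "\<bar>q n x * \<psi> x\<bar> \<le> \<bar>B\<bar> * C" "\<bar>q n x * partial j \<psi> x\<bar> \<le> \<bar>B\<bar> * C"
      "\<bar>partial j (q n) x * \<psi> x\<bar> \<le> \<bar>B\<bar> * C"
      using C(1)[of x] C(2)[of j x] \<psi>0[of x] d\<psi>0[of x j]
      by (cases "x \<in> K"; auto simp: abs_mult intro!: mult_mono)+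
  qed
  \<comment> \<open>The factor \<open>\<psi>\<close> confines the support to \<open>K\<close>;
    \<open>q n\<close> itself may be nonzero anywhere.\<close>
  have test: "test_function \<Omega> (\<lambda>x. q n x * \<psi> x)" for n
    unfolding test_function_def
    using smooth_mult[OF sm sm\<psi>, of "n + N"] K \<psi>0 by (auto simp: smooth_def q_def)
  have part: "partial j (\<lambda>x. q n x * \<psi> x) x = q n x * partial j \<psi> x + partial j (q n) x * \<psi> x" for n x
    unfolding q_def by (intro partial_mult smooth_differentiable sm sm\<psi>)
  have mq: "q n \<in> borel_measurable (lebesgue_on \<Omega>)" "partial j (q n) \<in> borel_measurable (lebesgue_on \<Omega>)" for n
    unfolding q_def by (intro smooth_measurable_lebesgue_on smooth_partial sm)+
  have m\<psi>: "\<psi> \<in> borel_measurable (lebesgue_on \<Omega>)" "partial j \<psi> \<in> borel_measurable (lebesgue_on \<Omega>)"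
    by (intro smooth_measurable_lebesgue_on smooth_partial sm\<psi>)+
  have mv: "(\<lambda>x. v x $ i) \<in> borel_measurable (lebesgue_on \<Omega>)"
    and mG: "(\<lambda>x. G x $ i $ j) \<in> borel_measurable (lebesgue_on \<Omega>)"
    using sv sG square_integrable_measurable by blast+
  have qlim: "(\<lambda>n. q n x) \<longlonglongrightarrow> \<phi> x" if "x \<in> \<Omega>" for x
    unfolding q_def using lim[OF that] by (rule LIMSEQ_ignore_initial_segment)
  have qDlim: "AE x in lebesgue_on \<Omega>. (\<lambda>n. partial j (q n) x) \<longlonglongrightarrow> D j x"
    using Dlim unfolding q_def by eventually_elim (rule LIMSEQ_ignore_initial_segment)
  have L: "(\<lambda>n. \<integral>x. v x $ i * partial j (\<lambda>x. q n x * \<psi> x) x \<partial>lebesgue_on \<Omega>)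
      \<longlonglongrightarrow> (\<integral>x. v x $ i * (\<phi> x * partial j \<psi> x + D j x * \<psi> x) \<partial>lebesgue_on \<Omega>)"
    unfolding part
  proof (rule integral_dominated_convergence)
    show "(\<lambda>x. v x $ i * (\<phi> x * partial j \<psi> x + D j x * \<psi> x)) \<in> borel_measurable (lebesgue_on \<Omega>)"
      by (intro borel_measurable_times borel_measurable_add mv m\<psi> \<phi> D)
    show "(\<lambda>x. v x $ i * (q n x * partial j \<psi> x + partial j (q n) x * \<psi> x)) \<in> borel_measurable (lebesgue_on \<Omega>)" for n
      by (intro borel_measurable_times borel_measurable_add mv m\<psi> mq)
    show "integrable (lebesgue_on \<Omega>) (\<lambda>x. \<bar>v x $ i\<bar> * (2 * (\<bar>B\<bar> * C)))"
      using square_integrable_imp_integrable[OF sv lmeasurable_\<Omega>] by simp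
    have "AE x in lebesgue_on \<Omega>. x \<in> \<Omega>" by (intro AE_I2) simp
    then show "AE x in lebesgue_on \<Omega>. (\<lambda>n. v x $ i * (q n x * partial j \<psi> x + partial j (q n) x * \<psi> x))
        \<longlonglongrightarrow> v x $ i * (\<phi> x * partial j \<psi> x + D j x * \<psi> x)"
      using qDlim by eventually_elim (intro tendsto_intros qlim)
    show "AE x in lebesgue_on \<Omega>. norm (v x $ i * (q n x * partial j \<psi> x + partial j (q n) x * \<psi> x))
        \<le> \<bar>v x $ i\<bar> * (2 * (\<bar>B\<bar> * C))" for n
    proof (intro AE_I2)
      fix x
      have "\<bar>q n x * partial j \<psi> x + partial j (q n) x * \<psi> x\<bar> \<le> 2 * (\<bar>B\<bar> * C)"
        using q\<psi>[of n x] by linarith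
      then show "norm (v x $ i * (q n x * partial j \<psi> x + partial j (q n) x * \<psi> x))
          \<le> \<bar>v x $ i\<bar> * (2 * (\<bar>B\<bar> * C))"
        by (simp add: abs_mult mult_left_mono)
    qed
  qed
  have R: "(\<lambda>n. \<integral>x. G x $ i $ j * (q n x * \<psi> x) \<partial>lebesgue_on \<Omega>)
      \<longlonglongrightarrow> (\<integral>x. G x $ i $ j * (\<phi> x * \<psi> x) \<partial>lebesgue_on \<Omega>)"
  proof (rule integral_dominated_convergence)
    show "(\<lambda>x. G x $ i $ j * (\<phi> x * \<psi> x)) \<in> borel_measurable (lebesgue_on \<Omega>)"
      by (intro borel_measurable_times mG m\<psi> \<phi>)
    show "(\<lambda>x. G x $ i $ j * (q n x * \<psi> x)) \<in> borel_measurable (lebesgue_on \<Omega>)" for n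
      by (intro borel_measurable_times mG m\<psi> mq)
    show "integrable (lebesgue_on \<Omega>) (\<lambda>x. \<bar>G x $ i $ j\<bar> * (\<bar>B\<bar> * C))"
      using square_integrable_imp_integrable[OF sG lmeasurable_\<Omega>] by simp
    show "AE x in lebesgue_on \<Omega>. (\<lambda>n. G x $ i $ j * (q n x * \<psi> x)) \<longlonglongrightarrow> G x $ i $ j * (\<phi> x * \<psi> x)"
      by (intro AE_I2 tendsto_intros qlim) simp
    show "AE x in lebesgue_on \<Omega>. norm (G x $ i $ j * (q n x * \<psi> x)) \<le> \<bar>G x $ i $ j\<bar> * (\<bar>B\<bar> * C)" for n
      using q\<psi>(1)[of n] by (intro AE_I2) (simp add: abs_mult[of "G _ $ i $ j"] mult_left_mono)
  qed
  have "(\<integral>x. v x $ i * partial j (\<lambda>x. q n x * \<psi> x) x \<partial>lebesgue_on \<Omega>)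
      = - (\<integral>x. G x $ i $ j * (q n x * \<psi> x) \<partial>lebesgue_on \<Omega>)" for n
    using G test[of n] unfolding weak_gradient_def by blast
  then have eq: "(\<integral>x. v x $ i * (\<phi> x * partial j \<psi> x + D j x * \<psi> x) \<partial>lebesgue_on \<Omega>)
      = - (\<integral>x. G x $ i $ j * (\<phi> x * \<psi> x) \<partial>lebesgue_on \<Omega>)"
    using LIMSEQ_unique[OF L] tendsto_minus[OF R] by simp
  note I1 = integrable_mult_test(2)[OF s\<phi>v[of i] \<psi>, of j]
  note I2 = integrable_mult_test(1)[OF sDv[of j i] \<psi>]
  note I3 = integrable_mult_test(1)[OF s\<phi>G[of i j] \<psi>]
  have "(\<integral>x. v x $ i * (\<phi> x * partial j \<psi> x + D j x * \<psi> x) \<partial>lebesgue_on \<Omega>)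
      = (\<integral>x. \<phi> x * v x $ i * partial j \<psi> x + D j x * v x $ i * \<psi> x \<partial>lebesgue_on \<Omega>)"
    by (simp add: algebra_simps)
  also have "\<dots> = (\<integral>x. \<phi> x * v x $ i * partial j \<psi> x \<partial>lebesgue_on \<Omega>)
      + (\<integral>x. D j x * v x $ i * \<psi> x \<partial>lebesgue_on \<Omega>)"
    by (rule Bochner_Integration.integral_add[OF I1 I2])
  finally have 1: "(\<integral>x. \<phi> x * v x $ i * partial j \<psi> x \<partial>lebesgue_on \<Omega>)
      = - (\<integral>x. \<phi> x * G x $ i $ j * \<psi> x \<partial>lebesgue_on \<Omega>) - (\<integral>x. D j x * v x $ i * \<psi> x \<partial>lebesgue_on \<Omega>)"
    using eq by (simp add: mult_ac)
  have "(\<integral>x. (\<chi> i j. \<phi> x * G x $ i $ j + D j x * v x $ i) $ i $ j * \<psi> x \<partial>lebesgue_on \<Omega>)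
      = (\<integral>x. \<phi> x * G x $ i $ j * \<psi> x + D j x * v x $ i * \<psi> x \<partial>lebesgue_on \<Omega>)"
    by (simp add: distrib_right)
  also have "\<dots> = (\<integral>x. \<phi> x * G x $ i $ j * \<psi> x \<partial>lebesgue_on \<Omega>) + (\<integral>x. D j x * v x $ i * \<psi> x \<partial>lebesgue_on \<Omega>)"
    by (rule Bochner_Integration.integral_add[OF I3 I2])
  finally show "(\<integral>x. (\<phi> x *\<^sub>R v x) $ i * partial j \<psi> x \<partial>lebesgue_on \<Omega>)
      = - (\<integral>x. (\<chi> i j. \<phi> x * G x $ i $ j + D j x * v x $ i) $ i $ j * \<psi> x \<partial>lebesgue_on \<Omega>)"
    using 1 by simp
qed

end

subsection \<open>Multiplication by piecewise affine functions\<close>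

text \<open>The preimages of the pieces under the segment's parametrisation are finitely many closed
  sets covering the unit interval. On each of them the function has the Lipschitz constant of its
  slope, and a Lipschitz bound on finitely many closed pieces extends to the whole interval.\<close>

lemma piecewise_affine_lipschitz:
  fixes \<phi> :: "'a::real_inner \<Rightarrow> real"
  assumes "finite \<T>" and closed: "\<And>T. T \<in> \<T> \<Longrightarrow> closed T"
    and aff: "\<And>T x. T \<in> \<T> \<Longrightarrow> x \<in> T \<Longrightarrow> \<phi> x = a T \<bullet> x + b T"
    and L: "\<And>T. T \<in> \<T> \<Longrightarrow> norm (a T) \<le> L" "0 \<le> L"
    and seg: "closed_segment p q \<subseteq> \<Union>\<T>"
  shows "\<bar>\<phi> q - \<phi> p\<bar> \<le> L * norm (q - p)"
proof -
  let ?f = "\<lambda>s. \<phi> (linepath p q s)"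
  have "(L * norm (q - p))-lipschitz_on {0..1} ?f"
  proof (rule lipschitz_on_closed_Union[where I = \<T> and U = "\<lambda>T. linepath p q -` T"])
    fix T assume T: "T \<in> \<T>"
    show "closed (linepath p q -` T)"
      using closed[OF T] by (intro closed_vimage continuous_intros)
    show "(L * norm (q - p))-lipschitz_on (linepath p q -` T) ?f"
    proof (rule lipschitz_onI)
      fix s s' assume s: "s \<in> linepath p q -` T" "s' \<in> linepath p q -` T"
      have "?f s - ?f s' = a T \<bullet> (linepath p q s - linepath p q s')"
        using s aff[OF T] by (simp add: inner_diff_right)
      also have "linepath p q s - linepath p q s' = (s - s') *\<^sub>R (q - p)"
        by (simp add: linepath_def algebra_simps)
      finally have "\<bar>?f s - ?f s'\<bar> \<le> norm (a T) * norm ((s - s') *\<^sub>R (q - p))"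
        by (metis Cauchy_Schwarz_ineq2)
      also have "\<dots> \<le> L * norm ((s - s') *\<^sub>R (q - p))"
        by (intro mult_right_mono L T) simp
      finally show "dist (?f s) (?f s') \<le> L * norm (q - p) * dist s s'"
        by (simp add: dist_real_def mult_ac)
    qed (use L in simp)
  next
    show "{0..1} \<subseteq> (\<Union>T\<in>\<T>. linepath p q -` T)"
      using seg linepath_in_path by fastforce
  qed (use L assms(1) in auto)
  from lipschitz_onD[OF this, of 1 0] show ?thesis
    by (simp add: dist_real_def linepath_def)
qed

lemma norm_le_of_mem_box:
  assumes "y \<in> box (vec (- \<delta>)) (vec \<delta> :: real^2)"
  shows "norm y < 2 * \<delta>"
proof -
  have "norm y \<le> (\<Sum>i\<in>UNIV. \<bar>y $ i\<bar>)" by (rule norm_le_l1_cart)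
  also have "\<dots> < 2 * \<delta>"
    using assms by (simp add: mem_box_cart sum_2 forall_2) arith
  finally show ?thesis .
qed

context bounded_open_set
begin

text \<open>Convolution needs a function on the plane, so a Tietze extension \<open>g\<close> of
  \<open>\<phi>\<close> is mollified. It is merely continuous outside the mesh, so derivative bounds
  are obtained only at points with a ball inside the domain or inside a triangle. Compact supports
  of test functions make this sufficient.\<close>

lemma piecewise_affine_mult_weak_gradient:
  fixes \<phi> :: "real^2 \<Rightarrow> real"
  assumes \<T>: "finite \<T>" "\<And>T. T \<in> \<T> \<Longrightarrow> closed T \<and> convex T" "\<Omega> \<subseteq> \<Union>\<T>"
    and cont: "continuous_on (\<Union>\<T>) \<phi>" and \<phi>1: "\<And>x. x \<in> \<Union>\<T> \<Longrightarrow> \<bar>\<phi> x\<bar> \<le> 1"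
    and aff: "\<forall>T\<in>\<T>. \<exists>a b. \<forall>x\<in>T. \<phi> x = a \<bullet> x + b"
    and v: "square_integrable \<Omega> v" and G: "weak_gradient \<Omega> v G"
  shows "\<exists>G'. weak_gradient \<Omega> (\<lambda>x. \<phi> x *\<^sub>R v x) G'"
proof -
  obtain a b where ab: "\<And>T x. T \<in> \<T> \<Longrightarrow> x \<in> T \<Longrightarrow> \<phi> x = a T \<bullet> x + b T"
    using aff by metis
  \<comment> \<open>A crude common Lipschitz constant: the sum dominates every single slope.\<close>
  define L where "L = (\<Sum>T\<in>\<T>. norm (a T))"
  have L0: "0 \<le> L" unfolding L_def by (simp add: sum_nonneg)
  have L: "norm (a T) \<le> L" if "T \<in> \<T>" for T
    unfolding L_def using that \<T>(1) by (intro member_le_sum) auto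
  obtain g where g: "continuous_on UNIV g" and g\<phi>: "\<And>x. x \<in> \<Union>\<T> \<Longrightarrow> g x = \<phi> x"
    and g1: "\<And>x. \<bar>g x\<bar> \<le> 1"
  proof -
    have "closed (\<Union>\<T>)" using \<T> by (intro closed_Union) auto
    then show thesis
      using Tietze[of "\<Union>\<T>" \<phi> UNIV 1] cont \<phi>1 that by auto
  qed
  obtain R where R: "\<And>x. x \<in> \<Omega> \<Longrightarrow> norm x \<le> R"
    using bounded_\<Omega> unfolding bounded_iff by blast
  \<comment> \<open>Each coordinate of the window must hold \<open>R\<close> for \<open>x\<close>, 1
    for the step \<open>t\<close> and 1 for \<open>y\<close>; \<open>R + 3\<close> leaves
    room.\<close>
  define w where "w = (vec (R + 3) :: real^2)"
  define \<delta> where "\<delta> n = 1 / real (Suc n)" for n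
  have \<delta>: "0 < \<delta> n" "\<delta> n \<le> 1" for n by (auto simp: \<delta>_def)
  \<comment> \<open>A shift \<open>y\<close> has norm below \<open>2 * \<delta> n\<close> and the
    step \<open>t\<close> is below \<open>\<delta> n\<close>, so all points involved stay within
    \<open>3 * \<delta> n\<close> of \<open>x\<close>.\<close>
  have \<delta>lim: "\<exists>N. \<forall>n\<ge>N. 3 * \<delta> n < r" if "r > 0" for r
  proof -
    have "(\<lambda>n. 3 * \<delta> n) \<longlonglongrightarrow> 3 * 0"
      unfolding \<delta>_def by (intro tendsto_intros lim_1_over_n[THEN LIMSEQ_Suc])
    then show ?thesis
      using that order_tendstoD(2)[of "\<lambda>n. 3 * \<delta> n" 0 sequentially r]
      by (simp add: eventually_sequentially)
  qed
  have win: "x + t *\<^sub>R axis j 1 - y \<in> cbox (- w) w"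
    if "x \<in> \<Omega>" "y \<in> box (vec (- \<delta> n)) (vec (\<delta> n))" "0 \<le> t" "t < 1" for x y t j n
  proof -
    have "(- w) $ i \<le> (x + t *\<^sub>R axis j 1 - y) $ i \<and> (x + t *\<^sub>R axis j 1 - y) $ i \<le> w $ i" for i
    proof -
      have "w $ i = R + 3" by (simp add: w_def)
      moreover have "\<bar>x $ i\<bar> \<le> R" using R[OF that(1)] component_le_norm_cart[of x i] by linarith
      moreover have "- \<delta> n < y $ i" "y $ i < \<delta> n"
        using that(2) by (auto simp: mem_box_cart)
      moreover have "\<bar>(t *\<^sub>R axis j 1 :: real^2) $ i\<bar> \<le> 1" using that by (simp add: axis_def)
      ultimately show ?thesis using \<delta>(2)[of n] unfolding vector_add_component vector_minus_component vector_uminus_component by linarith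
    qed
    then show ?thesis by (simp only: mem_box_cart) blast
  qed
  define p where "p n = mollify (- w) w (\<delta> n) g" for n
  have p_eq: "p n x = (\<integral>y. g (x - y) * bump_kernel (\<delta> n) y \<partial>lborel) / (\<integral>y. bump_kernel (\<delta> n) y \<partial>lborel)"
    if "x \<in> \<Omega>" for n x
    unfolding p_def using win[OF that, of _ n 0] by (intro mollify_eq g) simp
  have cg: "continuous_on UNIV (\<lambda>y. g (x - y))" for x
    by (intro continuous_on_compose2[OF g] continuous_intros subset_UNIV)
  have sm: "smooth (p n)" for n unfolding p_def by (rule smooth_mollify[OF g])
  have p1: "\<bar>p n x\<bar> \<le> 1" if "x \<in> \<Omega>" for n x
  proof -
    have "-1 \<le> g (x - y) \<and> g (x - y) \<le> 1" for y
      using g1[of "x - y"] by linarith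
    from bump_kernel_average_bounds[OF \<delta>(1)[of n] cg this] show ?thesis
      unfolding p_eq[OF that] by linarith
  qed
  have lim: "(\<lambda>n. p n x) \<longlonglongrightarrow> \<phi> x" if x: "x \<in> \<Omega>" for x
  proof (rule LIMSEQ_I)
    fix e :: real assume "e > 0"
    then obtain r where r: "r > 0" "\<And>y. dist y x < r \<Longrightarrow> dist (g y) (g x) < e / 2"
      using g unfolding continuous_on_iff by (metis UNIV_I half_gt_zero)
    obtain N where N: "\<And>n. n \<ge> N \<Longrightarrow> 3 * \<delta> n < r" using \<delta>lim[OF r(1)] by blast
    have "norm (p n x - \<phi> x) < e" if "n \<ge> N" for n
    proof -
      have "g x - e / 2 \<le> g (x - y) \<and> g (x - y) \<le> g x + e / 2"
        if "y \<in> box (vec (- \<delta> n)) (vec (\<delta> n))" for y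
      proof -
        have "dist (x - y) x < r"
          using norm_le_of_mem_box[OF that] N[OF \<open>n \<ge> N\<close>] \<delta>(1)[of n] by (simp add: dist_norm)
        from r(2)[OF this] show ?thesis unfolding dist_real_def by linarith
      qed
      from bump_kernel_average_bounds[OF \<delta>(1)[of n] cg this]
      have "\<bar>p n x - g x\<bar> \<le> e / 2" unfolding p_eq[OF x] by linarith
      moreover have "g x = \<phi> x" using g\<phi> x \<T>(3) by blast
      ultimately show ?thesis using \<open>e > 0\<close> unfolding real_norm_def by linarith
    qed
    then show "\<exists>N. \<forall>n\<ge>N. norm (p n x - \<phi> x) < e" by blast
  qed
  \<comment> \<open>Bounds for increments of \<open>g\<close> in a ball around \<open>x\<close> pass
    to the partial derivative at \<open>x\<close>. They are used with \<open>- L\<close> and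
    \<open>L\<close> in general, and with equal bounds inside a triangle.\<close>
  have part: "\<alpha> \<le> partial j (p n) x \<and> partial j (p n) x \<le> \<beta>"
    if "x \<in> \<Omega>" "3 * \<delta> n < r"
      and "\<And>x' x'' t. x' \<in> ball x r \<Longrightarrow> x'' \<in> ball x r \<Longrightarrow> 0 < t \<Longrightarrow> x'' = x' + t *\<^sub>R axis j 1 \<Longrightarrow>
        t * \<alpha> \<le> g x'' - g x' \<and> g x'' - g x' \<le> t * \<beta>" for x n r j \<alpha> \<beta>
    unfolding p_def
  proof (rule partial_mollify_bounds[where \<tau> = "\<delta> n", OF \<delta>(1) \<delta>(1) g])
    fix y :: "real^2" and t :: real assume y: "y \<in> box (vec (- \<delta> n)) (vec (\<delta> n))"
    show "x + t *\<^sub>R axis j 1 - y \<in> cbox (- w) w" if "0 \<le> t" "t < \<delta> n"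
      using win[OF \<open>x \<in> \<Omega>\<close> y] that \<delta>(2)[of n] by simp
    assume t: "0 < t" "t < \<delta> n"
    have "norm (t *\<^sub>R axis j 1 - y) < 3 * \<delta> n"
      using norm_triangle_ineq4[of "t *\<^sub>R axis j 1" y] norm_le_of_mem_box[OF y] t by simp
    moreover have "dist x (x + t *\<^sub>R axis j 1 - y) = norm (t *\<^sub>R axis j 1 - y)"
      by (metis add_diff_cancel_left' add_diff_eq dist_commute dist_norm)
    ultimately have "x + t *\<^sub>R axis j 1 - y \<in> ball x r"
      using that(2) by simp
    moreover have "x - y \<in> ball x r"
      using norm_le_of_mem_box[OF y] that(2) \<delta>(1)[of n] by (simp add: dist_norm)
    ultimately show "t * \<alpha> \<le> g (x + t *\<^sub>R axis j 1 - y) - g (x - y) \<and>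
        g (x + t *\<^sub>R axis j 1 - y) - g (x - y) \<le> t * \<beta>"
      using t by (intro that(3)) auto
  qed
  have partL: "\<bar>partial j (p n) x\<bar> \<le> L" if "x \<in> \<Omega>" "3 * \<delta> n < r" "ball x r \<subseteq> \<Omega>" for x n r j
  proof -
    have "- L \<le> partial j (p n) x \<and> partial j (p n) x \<le> L"
    proof (rule part[OF that(1,2)])
      fix x' x'' t assume *: "x' \<in> ball x r" "x'' \<in> ball x r" "0 < (t::real)" "x'' = x' + t *\<^sub>R axis j 1"
      have "closed_segment x' x'' \<subseteq> \<Union>\<T>"
        using closed_segment_subset[OF *(1,2) convex_ball] that(3) \<T>(3) by blast
      then have "\<bar>\<phi> x'' - \<phi> x'\<bar> \<le> L * norm (x'' - x')"
        using \<T> ab L L0 by (intro piecewise_affine_lipschitz[of \<T> \<phi> a b]) auto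
      moreover have "norm (x'' - x') = t" using * by simp
      moreover have "g x'' = \<phi> x''" "g x' = \<phi> x'"
        using g\<phi> that(3) \<T>(3) *(1,2) by blast+
      ultimately show "t * - L \<le> g x'' - g x' \<and> g x'' - g x' \<le> t * L"
        by (simp add: abs_le_iff mult.commute)
    qed
    then show ?thesis by linarith
  qed
  \<comment> \<open>Near \<open>x\<close> the function \<open>g\<close> is affine with slope
    \<open>a T\<close>, so lower and upper bound coincide: the derivative is exact from some index
    on.\<close>
  have part_eq: "\<forall>\<^sub>F n in sequentially. partial j (p n) x = a T $ j"
    if T: "T \<in> \<T>" "x \<in> interior T" "x \<in> \<Omega>" for x T j
  proof -
    obtain r where r: "r > 0" "ball x r \<subseteq> T"
      using T(2) mem_interior by blast
    obtain N where N: "\<And>n. n \<ge> N \<Longrightarrow> 3 * \<delta> n < r" using \<delta>lim[OF r(1)] by blast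
    have "a T $ j \<le> partial j (p n) x \<and> partial j (p n) x \<le> a T $ j" if "n \<ge> N" for n
    proof (rule part[OF T(3) N[OF that]])
      fix x' x'' t assume *: "x' \<in> ball x r" "x'' \<in> ball x r" "0 < (t::real)" "x'' = x' + t *\<^sub>R axis j 1"
      have "g y = a T \<bullet> y + b T" if "y \<in> ball x r" for y
        using g\<phi> ab[OF T(1)] T(1) r(2) that by (metis UnionI subsetD)
      then have "g x'' - g x' = a T \<bullet> (x'' - x')"
        using *(1,2) by (simp add: inner_diff_right)
      also have "\<dots> = t * a T $ j" using *(4) by (simp add: inner_axis)
      finally show "t * a T $ j \<le> g x'' - g x' \<and> g x'' - g x' \<le> t * a T $ j" by simp
    qed
    then show ?thesis unfolding eventually_sequentially by (meson order_antisym)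
  qed
  define U where "U = (\<Union>T\<in>\<T>. interior T)"
  \<comment> \<open>As a limit, \<open>D\<close> is measurable without choosing a triangle for each
    point; 0 is the default off the triangle interiors, which within the domain is a null
    set.\<close>
  define D where "D j x = (if x \<in> U then lim (\<lambda>n. partial j (p n) x) else 0)" for j x
  have Dlim: "(\<lambda>n. partial j (p n) x) \<longlonglongrightarrow> D j x \<and> \<bar>D j x\<bar> \<le> L" if x: "x \<in> U" "x \<in> \<Omega>" for x j
  proof -
    obtain T where T: "T \<in> \<T>" "x \<in> interior T" using x(1) U_def by blast
    have *: "(\<lambda>n. partial j (p n) x) \<longlonglongrightarrow> a T $ j"
      by (rule tendsto_eventually[OF part_eq[OF T x(2)]])
    then have "D j x = a T $ j" using x(1) limI by (simp add: D_def)
    then show ?thesis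
      using * component_le_norm_cart[of "a T" j] L[OF T(1)] by simp
  qed
  have aeU: "AE x in lebesgue_on \<Omega>. x \<in> U"
  proof -
    \<comment> \<open>A point of the domain lies in some triangle, hence in its interior or on its
      frontier, and frontiers of convex sets are negligible.\<close>
    have "negligible (\<Union>T\<in>\<T>. frontier T)"
      using \<T> by (intro negligible_Union) (auto intro: negligible_convex_frontier)
    then have "AE x in lebesgue. x \<notin> (\<Union>T\<in>\<T>. frontier T)"
      unfolding negligible_iff_null_sets by (rule AE_not_in)
    moreover have "x \<in> U" if "x \<in> \<Omega>" "x \<notin> (\<Union>T\<in>\<T>. frontier T)" for x
    proof -
      obtain T where "T \<in> \<T>" "x \<in> T" using \<open>x \<in> \<Omega>\<close> \<T>(3) by blast
      then show ?thesis
        using that(2) closure_subset[of T] unfolding U_def frontier_def by blast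
    qed
    ultimately have "AE x in lebesgue. x \<in> \<Omega> \<longrightarrow> x \<in> U"
      by (auto elim: eventually_mono)
    then show ?thesis
      using open_\<Omega> by (simp add: AE_restrict_space_iff)
  qed
  have mD: "D j \<in> borel_measurable (lebesgue_on \<Omega>)" for j
    unfolding D_def[abs_def]
  proof (rule measurable_If)
    show "(\<lambda>x. lim (\<lambda>n. partial j (p n) x)) \<in> borel_measurable (lebesgue_on \<Omega>)"
      by (intro borel_measurable_lim_metric smooth_measurable_lebesgue_on smooth_partial sm)
    have "open U" unfolding U_def by (intro open_UN ballI open_interior)
    then have "U \<in> sets lebesgue" by simp
    moreover have "{x \<in> space (lebesgue_on \<Omega>). x \<in> U} = \<Omega> \<inter> U" by auto
    ultimately show "{x \<in> space (lebesgue_on \<Omega>). x \<in> U} \<in> sets (lebesgue_on \<Omega>)"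
      unfolding sets_restrict_space by auto
  qed simp
  have m\<phi>: "\<phi> \<in> borel_measurable (lebesgue_on \<Omega>)"
    using continuous_on_subset[OF cont \<T>(3)] open_\<Omega>
    by (intro continuous_imp_measurable_on_sets_lebesgue) auto
  have "weak_gradient \<Omega> (\<lambda>x. \<phi> x *\<^sub>R v x) (\<lambda>x. \<chi> i j. \<phi> x * G x $ i $ j + D j x * v x $ i)"
  proof (rule weak_gradient_mult_limit[where B = "max 1 L", OF sm lim _ _ m\<phi> _ mD _ v G])
    show "AE x in lebesgue_on \<Omega>. (\<lambda>n. partial j (p n) x) \<longlonglongrightarrow> D j x" for j
    proof -
      have "AE x in lebesgue_on \<Omega>. x \<in> \<Omega>" by (intro AE_I2) simp
      then show ?thesis using aeU by eventually_elim (use Dlim in blast)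
    qed
    show "\<bar>\<phi> x\<bar> \<le> max 1 L" if "x \<in> \<Omega>" for x
    proof -
      have "\<bar>\<phi> x\<bar> \<le> 1" using \<phi>1 \<T>(3) that by blast
      then show ?thesis by simp
    qed
    show "\<bar>D j x\<bar> \<le> max 1 L" if "x \<in> \<Omega>" for j x
      using Dlim[of x j] that by (cases "x \<in> U") (auto simp: D_def)
    fix K assume K: "compact K" "K \<subseteq> \<Omega>"
    obtain r where r: "r > 0" "(\<Union>x\<in>K. ball x r) \<subseteq> \<Omega>"
      using compact_subset_open_imp_ball_epsilon_subset[OF K(1) open_\<Omega> K(2)] by blast
    obtain N where N: "\<And>n. n \<ge> N \<Longrightarrow> 3 * \<delta> n < r" using \<delta>lim[OF r(1)] by blast
    have "\<bar>p n x\<bar> \<le> max 1 L \<and> (\<forall>j. \<bar>partial j (p n) x\<bar> \<le> max 1 L)" if "n \<ge> N" "x \<in> K" for n x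
    proof -
      have "x \<in> \<Omega>" "ball x r \<subseteq> \<Omega>" using that K r(2) by blast+
      then show ?thesis using p1[of x n] partL[of x n r] N[OF that(1)] by (simp add: le_max_iff_disj)
    qed
    then show "\<exists>N. \<forall>n\<ge>N. \<forall>x\<in>K. \<bar>p n x\<bar> \<le> max 1 L \<and> (\<forall>j. \<bar>partial j (p n) x\<bar> \<le> max 1 L)" by blast
  qed
  then show ?thesis by blast
qed

end

subsection \<open>Hat functions\<close>

text \<open>By Krein-Milman, statements about affine functions on a triangle reduce to its extreme
  points, which are nodes, where the hat functions are known.\<close>

lemma triangle_eq_hull_extreme_points:
  assumes "triangulation_of \<T> \<Omega>" "T \<in> \<T>"
  shows "T = convex hull {x. x extreme_point_of T}" "{x. x extreme_point_of T} \<subseteq> nodes \<T>"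
    "finite {x. x extreme_point_of T}"
proof -
  have T: "2 simplex T" using assms unfolding triangulation_of_def by blast
  show "T = convex hull {x. x extreme_point_of T}"
    by (intro Krein_Milman_Minkowski compact_simplex[OF T] convex_simplex[OF T])
  show "{x. x extreme_point_of T} \<subseteq> nodes \<T>" using assms(2) unfolding nodes_def by blast
  obtain C where "finite C" "T = convex hull C" using T unfolding simplex by blast
  then show "finite {x. x extreme_point_of T}"
    using extreme_point_of_convex_hull[of _ C] by (auto intro: finite_subset[of _ C])
qed

lemma finite_nodes:
  assumes "triangulation_of \<T> \<Omega>"
  shows "finite (nodes \<T>)"
proof -
  have "nodes \<T> = (\<Union>T\<in>\<T>. {x. x extreme_point_of T})" unfolding nodes_def by blast
  moreover have "finite \<T>" using assms unfolding triangulation_of_def triangulation_def by blast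
  ultimately show ?thesis using triangle_eq_hull_extreme_points(3)[OF assms] by simp
qed

text \<open>On a triangle the bounds describe an intersection of two half-planes. It contains the
  extreme points, where the values are 0 or 1, and by convexity their hull.\<close>

lemma hat_function_bounds:
  assumes tri: "triangulation_of \<T> \<Omega>" and hat: "hat_function \<T> z \<phi>" and x: "x \<in> \<Union>\<T>"
  shows "0 \<le> \<phi> x \<and> \<phi> x \<le> 1"
proof -
  obtain T where T: "T \<in> \<T>" "x \<in> T" using x by blast
  note E = triangle_eq_hull_extreme_points[OF tri T(1)]
  obtain a b where ab: "\<And>x. x \<in> T \<Longrightarrow> \<phi> x = a \<bullet> x + b"
    using hat T(1) unfolding hat_function_def by metis
  have "{x. x extreme_point_of T} \<subseteq> {y. - b \<le> a \<bullet> y} \<inter> {y. a \<bullet> y \<le> 1 - b}"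
  proof
    fix y assume y: "y \<in> {x. x extreme_point_of T}"
    then have "y \<in> T" by (simp add: extreme_point_of_def)
    moreover have "\<phi> y = 0 \<or> \<phi> y = 1" using hat y E(2) unfolding hat_function_def by blast
    ultimately show "y \<in> {y. - b \<le> a \<bullet> y} \<inter> {y. a \<bullet> y \<le> 1 - b}" using ab[of y] by auto
  qed
  moreover have "convex ({y. - b \<le> a \<bullet> y} \<inter> {y. a \<bullet> y \<le> 1 - b})"
    by (intro convex_Int convex_halfspace_le convex_halfspace_ge[of "- b" a, simplified])
  ultimately have "x \<in> {y. - b \<le> a \<bullet> y} \<inter> {y. a \<bullet> y \<le> 1 - b}"
    using T(2) E(1) hull_minimal by blast
  then show ?thesis using ab[OF T(2)] by auto
qed

text \<open>On each triangle the sum is affine, and at an extreme point exactly one summand is 1 and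
  the others are 0. The set where an affine function equals 1 is convex, so it contains the
  hull.\<close>

lemma hat_functions_sum:
  assumes tri: "triangulation_of \<T> \<Omega>" and hat: "\<And>z. z \<in> nodes \<T> \<Longrightarrow> hat_function \<T> z (\<phi> z)"
    and x: "x \<in> \<Union>\<T>"
  shows "(\<Sum>z\<in>nodes \<T>. \<phi> z x) = 1"
proof -
  obtain T where T: "T \<in> \<T>" "x \<in> T" using x by blast
  note E = triangle_eq_hull_extreme_points[OF tri T(1)]
  have "\<forall>z\<in>nodes \<T>. \<exists>a b. \<forall>x\<in>T. \<phi> z x = a \<bullet> x + b"
    using hat T(1) unfolding hat_function_def by blast
  then obtain a b where ab: "\<And>z x. z \<in> nodes \<T> \<Longrightarrow> x \<in> T \<Longrightarrow> \<phi> z x = a z \<bullet> x + b z"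
    by metis
  define A where "A = (\<Sum>z\<in>nodes \<T>. a z)"
  define B where "B = (\<Sum>z\<in>nodes \<T>. b z)"
  have AB: "(\<Sum>z\<in>nodes \<T>. \<phi> z y) = A \<bullet> y + B" if "y \<in> T" for y
    using that by (simp add: ab A_def B_def inner_sum_left sum.distrib cong: sum.cong)
  have sub: "{x. x extreme_point_of T} \<subseteq> {y. A \<bullet> y = 1 - B}"
  proof
    fix y assume y: "y \<in> {x. x extreme_point_of T}"
    then have "y \<in> nodes \<T>" "y \<in> T" using E(2) by (auto simp: extreme_point_of_def)
    moreover have "\<phi> z y = (if z = y then 1 else 0)" if "z \<in> nodes \<T>" for z
      using hat[OF that] \<open>y \<in> nodes \<T>\<close> unfolding hat_function_def by auto
    ultimately have "(\<Sum>z\<in>nodes \<T>. \<phi> z y) = 1"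
      using finite_nodes[OF tri] by simp
    then show "y \<in> {y. A \<bullet> y = 1 - B}" using AB[OF \<open>y \<in> T\<close>] by simp
  qed
  have "x \<in> {y. A \<bullet> y = 1 - B}"
    using T(2) E(1) hull_minimal[of _ _ convex, OF sub convex_hyperplane] by blast
  then show ?thesis using AB[OF T(2)] by simp
qed

subsection \<open>The space with boundary conditions\<close>

lemma square_integrable_diff:
  "square_integrable S f \<Longrightarrow> square_integrable S g \<Longrightarrow> square_integrable S (\<lambda>x. f x - g x)"
  using square_integrable_add[OF _ square_integrable_scaleR[of S g "-1"]] by simp

lemma continuous_square_integrable_interval:
  fixes f :: "real \<Rightarrow> 'b::euclidean_space"
  assumes "continuous_on {a..b} f"
  shows "square_integrable {a..b} f"
  unfolding square_integrable_def
  using assms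
  by (auto intro!: continuous_imp_measurable_on_sets_lebesgue continuous_imp_integrable_real continuous_intros)

context bounded_open_set
begin

text \<open>The approximating sequences are combined termwise. The gradient of a combination is the
  combined gradient only almost everywhere, which \<open>l2_norm_cong_AE\<close> absorbs.\<close>

lemma has_trace_add_scaleR:
  assumes v: "v \<in> H1 \<Omega>" and w: "w \<in> H1 \<Omega>" and g: "has_trace \<Omega> v g" and h: "has_trace \<Omega> w h"
  shows "has_trace \<Omega> (\<lambda>x. v x + t *\<^sub>R w x) (\<lambda>x. g x + t *\<^sub>R h x)"
proof -
  obtain vs where vs: "\<And>n. vs n \<in> H1 \<Omega>" "\<And>n. continuous_on (closure \<Omega>) (vs n)"
    "(\<lambda>n. l2_norm \<Omega> (\<lambda>x. vs n x - v x)) \<longlonglongrightarrow> 0"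
    "(\<lambda>n. l2_norm \<Omega> (\<lambda>x. grad \<Omega> (vs n) x - grad \<Omega> v x)) \<longlonglongrightarrow> 0"
    and gs: "\<And>a b. a \<noteq> b \<Longrightarrow> closed_segment a b \<subseteq> frontier \<Omega> \<Longrightarrow> square_integrable {0..1} (\<lambda>t. g (linepath a b t))"
    "\<And>a b. a \<noteq> b \<Longrightarrow> closed_segment a b \<subseteq> frontier \<Omega> \<Longrightarrow>
      (\<lambda>n. l2_norm {0..1} (\<lambda>t. vs n (linepath a b t) - g (linepath a b t))) \<longlonglongrightarrow> 0"
    using g unfolding has_trace_def by blast
  obtain ws where ws: "\<And>n. ws n \<in> H1 \<Omega>" "\<And>n. continuous_on (closure \<Omega>) (ws n)"
    "(\<lambda>n. l2_norm \<Omega> (\<lambda>x. ws n x - w x)) \<longlonglongrightarrow> 0"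
    "(\<lambda>n. l2_norm \<Omega> (\<lambda>x. grad \<Omega> (ws n) x - grad \<Omega> w x)) \<longlonglongrightarrow> 0"
    and hs: "\<And>a b. a \<noteq> b \<Longrightarrow> closed_segment a b \<subseteq> frontier \<Omega> \<Longrightarrow> square_integrable {0..1} (\<lambda>t. h (linepath a b t))"
    "\<And>a b. a \<noteq> b \<Longrightarrow> closed_segment a b \<subseteq> frontier \<Omega> \<Longrightarrow>
      (\<lambda>n. l2_norm {0..1} (\<lambda>t. ws n (linepath a b t) - h (linepath a b t))) \<longlonglongrightarrow> 0"
    using h unfolding has_trace_def by blast
  define us where "us n = (\<lambda>x. vs n x + t *\<^sub>R ws n x)" for n
  have diff: "us n x - (p + t *\<^sub>R q) = (vs n x - p) + t *\<^sub>R (ws n x - q)" for n x p q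
    by (simp add: us_def algebra_simps)
  have "us n \<in> H1 \<Omega> \<and> continuous_on (closure \<Omega>) (us n)" for n
    unfolding us_def using vs ws by (auto intro!: H1_add_scaleR continuous_intros)
  moreover have "(\<lambda>n. l2_norm \<Omega> (\<lambda>x. us n x - (v x + t *\<^sub>R w x))) \<longlonglongrightarrow> 0"
    unfolding diff
    by (intro l2_norm_lincomb_tendsto_0 square_integrable_diff H1_square_integrable vs ws v w)
  moreover have "(\<lambda>n. l2_norm \<Omega> (\<lambda>x. grad \<Omega> (us n) x - grad \<Omega> (\<lambda>x. v x + t *\<^sub>R w x) x)) \<longlonglongrightarrow> 0"
  proof -
    have "l2_norm \<Omega> (\<lambda>x. grad \<Omega> (us n) x - grad \<Omega> (\<lambda>x. v x + t *\<^sub>R w x) x)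
      = l2_norm \<Omega> (\<lambda>x. (grad \<Omega> (vs n) x - grad \<Omega> v x) + t *\<^sub>R (grad \<Omega> (ws n) x - grad \<Omega> w x))" for n
    proof (rule l2_norm_cong_AE)
      show "AE x in lebesgue_on \<Omega>. grad \<Omega> (us n) x - grad \<Omega> (\<lambda>x. v x + t *\<^sub>R w x) x
          = (grad \<Omega> (vs n) x - grad \<Omega> v x) + t *\<^sub>R (grad \<Omega> (ws n) x - grad \<Omega> w x)"
        using grad_add_scaleR[OF vs(1)[of n] ws(1)[of n], of t] grad_add_scaleR[OF v w, of t]
        unfolding us_def by eventually_elim (simp add: algebra_simps)
      show "(\<lambda>x. grad \<Omega> (us n) x - grad \<Omega> (\<lambda>x. v x + t *\<^sub>R w x) x) \<in> borel_measurable (lebesgue_on \<Omega>)"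
        unfolding us_def
        by (intro square_integrable_measurable square_integrable_diff H1_grad_square_integrable
            H1_add_scaleR vs ws v w)
      show "(\<lambda>x. (grad \<Omega> (vs n) x - grad \<Omega> v x) + t *\<^sub>R (grad \<Omega> (ws n) x - grad \<Omega> w x))
          \<in> borel_measurable (lebesgue_on \<Omega>)"
        by (intro square_integrable_measurable square_integrable_add square_integrable_scaleR
            square_integrable_diff H1_grad_square_integrable vs ws v w)
    qed
    then show ?thesis
      using l2_norm_lincomb_tendsto_0[OF _ _ vs(4) ws(4), of t]
      by (simp add: square_integrable_diff H1_grad_square_integrable vs ws v w)
  qed
  moreover have "square_integrable {0..1} (\<lambda>s. g (linepath a b s) + t *\<^sub>R h (linepath a b s)) \<and>
      (\<lambda>n. l2_norm {0..1} (\<lambda>s. us n (linepath a b s) - (g (linepath a b s) + t *\<^sub>R h (linepath a b s)))) \<longlonglongrightarrow> 0"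
    if ab: "a \<noteq> b" "closed_segment a b \<subseteq> frontier \<Omega>" for a b
  proof -
    have sq: "square_integrable {0..1} (\<lambda>s. f (linepath a b s))"
      if "continuous_on (closure \<Omega>) f" for f :: vfield
    proof (rule continuous_square_integrable_interval, rule continuous_on_compose2[OF that])
      show "linepath a b ` {0..1} \<subseteq> closure \<Omega>"
        using ab(2) unfolding linepath_image_01 frontier_def by blast
    qed (intro continuous_intros)
    show ?thesis
      unfolding diff
      by (intro conjI square_integrable_add square_integrable_scaleR l2_norm_lincomb_tendsto_0
          square_integrable_diff sq vs ws gs[OF ab] hs[OF ab])
  qed
  ultimately show ?thesis
    unfolding has_trace_def by (intro exI[of _ us]) blast
qed

lemma H_space_subset_H1: "H_space \<Omega> \<Gamma>D \<Gamma>g \<subseteq> H1 \<Omega>"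
  by (auto simp: H_space_def)

text \<open>Both boundary conditions are linear and homogeneous, so the combined trace witness
  \<open>g + t *\<^sub>R h\<close> satisfies them off the union of two null sets.\<close>

lemma H_space_add_scaleR:
  assumes "v \<in> H_space \<Omega> \<Gamma>D \<Gamma>g" "w \<in> H_space \<Omega> \<Gamma>D \<Gamma>g"
  shows "(\<lambda>x. v x + t *\<^sub>R w x) \<in> H_space \<Omega> \<Gamma>D \<Gamma>g"
proof -
  obtain g where v: "v \<in> H1 \<Omega>" "has_trace \<Omega> v g" and gD: "boundary_AE \<Gamma>D (\<lambda>x. g x = 0)"
    and gg: "boundary_AE \<Gamma>g (\<lambda>x. g x \<bullet> outer_normal \<Omega> x = 0)"
    using assms(1) unfolding H_space_def by blast
  obtain h where w: "w \<in> H1 \<Omega>" "has_trace \<Omega> w h" and hD: "boundary_AE \<Gamma>D (\<lambda>x. h x = 0)"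
    and hg: "boundary_AE \<Gamma>g (\<lambda>x. h x \<bullet> outer_normal \<Omega> x = 0)"
    using assms(2) unfolding H_space_def by blast
  have conj: "boundary_AE \<Gamma> R" if P: "boundary_AE \<Gamma> P" and Q: "boundary_AE \<Gamma> Q"
    and "\<And>x. P x \<Longrightarrow> Q x \<Longrightarrow> R x" for \<Gamma> P Q R
    unfolding boundary_AE_def
  proof (intro allI impI)
    fix a b assume ab: "a \<noteq> b \<and> closed_segment a b \<subseteq> \<Gamma>"
    have "AE s in lebesgue_on {0..1}. P (linepath a b s)" "AE s in lebesgue_on {0..1}. Q (linepath a b s)"
      using P Q ab unfolding boundary_AE_def by blast+
    then show "AE s in lebesgue_on {0..1}. R (linepath a b s)"
      by eventually_elim (rule that(3))
  qed
  have "boundary_AE \<Gamma>D (\<lambda>x. g x + t *\<^sub>R h x = 0)"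
    by (rule conj[OF gD hD]) simp
  moreover have "boundary_AE \<Gamma>g (\<lambda>x. (g x + t *\<^sub>R h x) \<bullet> outer_normal \<Omega> x = 0)"
    by (rule conj[OF gg hg]) (simp add: inner_add_left)
  ultimately show ?thesis
    using H1_add_scaleR[OF v(1) w(1)] has_trace_add_scaleR[OF v(1) w(1) v(2) w(2)]
    unfolding H_space_def by blast
qed

end

subsection \<open>Bilinear forms and the residual\<close>

lemma transpose_strain: "transpose (strain \<Omega> v x) = strain \<Omega> v x"
  by (simp add: strain_def transpose_def vec_eq_iff)

lemma a_form_commute:
  assumes "spd_tensor C"
  shows "a_form \<Omega> C u v = a_form \<Omega> C v u"
proof -
  have "C (strain \<Omega> u x) \<bullet> strain \<Omega> v x = C (strain \<Omega> v x) \<bullet> strain \<Omega> u x" for x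
    using assms transpose_strain unfolding spd_tensor_def by (metis inner_commute)
  then show ?thesis by (simp add: a_form_def)
qed

text \<open>For symmetric A the symmetry of \<open>S\<close> gives S (S A) : A = S A : S A, and
  strains are symmetric. This also makes the energy nonnegative.\<close>

lemma a_form_eq_sqrt:
  assumes "tensor_sqrt C S"
  shows "a_form \<Omega> C v v = (\<integral>x. (norm (S (strain \<Omega> v x)))\<^sup>2 \<partial>lebesgue_on \<Omega>)"
proof -
  have S: "spd_tensor S" and SS: "\<And>A. transpose A = A \<Longrightarrow> S (S A) = C A"
    using assms unfolding tensor_sqrt_def by auto
  have "C A \<bullet> A = (norm (S A))\<^sup>2" if A: "transpose A = A" for A
  proof -
    have "transpose (S A) = S A" using S A unfolding spd_tensor_def by blast
    then have "S (S A) \<bullet> A = S A \<bullet> S A" using S A unfolding spd_tensor_def by blast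
    then show ?thesis using SS[OF A] by (simp add: power2_norm_eq_inner)
  qed
  then show ?thesis by (simp add: a_form_def transpose_strain)
qed

lemma l2_inner_commute: "l2_inner S f g = l2_inner S g f"
  by (simp add: l2_inner_def inner_commute)

lemma l2_inner_self: "l2_inner S f f = (l2_norm S f)\<^sup>2"
  by (simp add: l2_inner_def l2_norm_square power2_norm_eq_inner)

lemma l2_inner_add_scaleR:
  assumes "square_integrable S f" "square_integrable S g" "square_integrable S h"
  shows "l2_inner S f (\<lambda>x. g x + t *\<^sub>R h x) = l2_inner S f g + t * l2_inner S f h"
  unfolding l2_inner_def by (simp add: inner_add_right square_integrable_inner assms)

lemma l2_inner_sum:
  assumes "square_integrable S f" "\<And>z. z \<in> N \<Longrightarrow> square_integrable S (g z)"
  shows "l2_inner S f (\<lambda>x. \<Sum>z\<in>N. g z x) = (\<Sum>z\<in>N. l2_inner S f (g z))"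
  unfolding l2_inner_def by (simp add: inner_sum_right square_integrable_inner assms)

context bounded_open_set
begin

lemma square_integrable_tensor_strain:
  assumes "spd_tensor C" "v \<in> H1 \<Omega>"
  shows "square_integrable \<Omega> (\<lambda>x. C (strain \<Omega> v x))"
  using assms square_integrable_linear[OF _ strain_square_integrable] unfolding spd_tensor_def by blast

text \<open>Lets a strain be replaced by an expression that is known only almost everywhere, such as
  the sum of two strains.\<close>

lemma a_form_cong_AE:
  assumes C: "spd_tensor C" "u \<in> H1 \<Omega>" "v \<in> H1 \<Omega>"
    and ae: "AE x in lebesgue_on \<Omega>. strain \<Omega> v x = E x" and E: "E \<in> borel_measurable (lebesgue_on \<Omega>)"
  shows "a_form \<Omega> C u v = (\<integral>x. C (strain \<Omega> u x) \<bullet> E x \<partial>lebesgue_on \<Omega>)"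
  unfolding a_form_def
proof (rule integral_cong_AE)
  show "(\<lambda>x. C (strain \<Omega> u x) \<bullet> strain \<Omega> v x) \<in> borel_measurable (lebesgue_on \<Omega>)"
    and "(\<lambda>x. C (strain \<Omega> u x) \<bullet> E x) \<in> borel_measurable (lebesgue_on \<Omega>)"
    by (intro borel_measurable_inner E square_integrable_measurable square_integrable_tensor_strain
        strain_square_integrable C)+
  show "AE x in lebesgue_on \<Omega>. C (strain \<Omega> u x) \<bullet> strain \<Omega> v x = C (strain \<Omega> u x) \<bullet> E x"
    using ae by eventually_elim simp
qed

lemma a_form_add_scaleR:
  assumes C: "spd_tensor C" and u: "u \<in> H1 \<Omega>" and v: "v \<in> H1 \<Omega>" and w: "w \<in> H1 \<Omega>"
  shows "a_form \<Omega> C u (\<lambda>x. v x + t *\<^sub>R w x) = a_form \<Omega> C u v + t * a_form \<Omega> C u w"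
proof -
  have "a_form \<Omega> C u (\<lambda>x. v x + t *\<^sub>R w x)
      = (\<integral>x. C (strain \<Omega> u x) \<bullet> (strain \<Omega> v x + t *\<^sub>R strain \<Omega> w x) \<partial>lebesgue_on \<Omega>)"
    by (intro a_form_cong_AE C u H1_add_scaleR v w strain_add_scaleR square_integrable_measurable
        square_integrable_add square_integrable_scaleR strain_square_integrable)
  also have "\<dots> = a_form \<Omega> C u v + t * a_form \<Omega> C u w"
    unfolding a_form_def
    by (simp add: inner_add_right square_integrable_inner square_integrable_tensor_strain
        strain_square_integrable C u v w)
  finally show ?thesis .
qed

lemma a_form_sum:
  assumes C: "spd_tensor C" and u: "u \<in> H1 \<Omega>" and "finite N" and v: "\<And>z. z \<in> N \<Longrightarrow> v z \<in> H1 \<Omega>"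
  shows "a_form \<Omega> C u (\<lambda>x. \<Sum>z\<in>N. v z x) = (\<Sum>z\<in>N. a_form \<Omega> C u (v z))"
proof -
  have "a_form \<Omega> C u (\<lambda>x. \<Sum>z\<in>N. v z x)
      = (\<integral>x. C (strain \<Omega> u x) \<bullet> (\<Sum>z\<in>N. strain \<Omega> (v z) x) \<partial>lebesgue_on \<Omega>)"
    using H1_sum_strain[OF assms(3) v]
    by (intro a_form_cong_AE C u borel_measurable_sum square_integrable_measurable
        strain_square_integrable v) auto
  also have "\<dots> = (\<Sum>z\<in>N. a_form \<Omega> C u (v z))"
    unfolding a_form_def
    by (simp add: inner_sum_right square_integrable_inner square_integrable_tensor_strain
        strain_square_integrable C u v)
  finally show ?thesis .
qed

section \<open>Localisation with hat functions\<close>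

lemma triangulation_of_cover:
  assumes "triangulation_of \<T> \<Omega>"
  shows "finite \<T>" "\<And>T. T \<in> \<T> \<Longrightarrow> closed T \<and> convex T" "\<Omega> \<subseteq> \<Union>\<T>"
  using assms closed_simplex convex_simplex closure_subset[of \<Omega>]
  unfolding triangulation_of_def triangulation_def by blast+

lemma hat_function_measurable:
  assumes tri: "triangulation_of \<T> \<Omega>" and hat: "hat_function \<T> z \<phi>"
  shows "\<phi> \<in> borel_measurable (lebesgue_on \<Omega>)"
proof -
  have "continuous_on \<Omega> \<phi>"
    using hat continuous_on_subset triangulation_of_cover(3)[OF tri] unfolding hat_function_def by blast
  then show ?thesis
    using open_\<Omega> by (intro continuous_imp_measurable_on_sets_lebesgue) auto
qed

text \<open>Membership in \<open>H1\<close> is what gives the local residual its meaning; the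
  boundary conditions of the product play no part in the linearity of the residual.\<close>

lemma hat_function_mult_H1:
  assumes tri: "triangulation_of \<T> \<Omega>" and hat: "hat_function \<T> z \<phi>" and v: "v \<in> H1 \<Omega>"
  shows "(\<lambda>x. \<phi> x *\<^sub>R v x) \<in> H1 \<Omega>"
proof -
  note \<T> = triangulation_of_cover[OF tri]
  have le1: "\<bar>\<phi> x\<bar> \<le> 1" if "x \<in> \<Union>\<T>" for x
    using hat_function_bounds[OF tri hat that] by simp
  have "\<exists>G. weak_gradient \<Omega> (\<lambda>x. \<phi> x *\<^sub>R v x) G"
    using hat unfolding hat_function_def
    by (intro piecewise_affine_mult_weak_gradient[OF \<T> _ le1 _ H1_square_integrable[OF v] H1_weak_gradient[OF v]])
       auto
  moreover have "square_integrable \<Omega> (\<lambda>x. \<phi> x *\<^sub>R v x)"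
  proof (rule square_integrable_mult_bounded[OF H1_square_integrable[OF v] hat_function_measurable[OF tri hat]])
    show "\<bar>\<phi> x\<bar> \<le> 1" if "x \<in> \<Omega>" for x using le1 \<T>(3) that by blast
  qed
  ultimately show ?thesis by (simp add: H1_def)
qed

lemma residual_add_scaleR:
  assumes "spd_tensor C" "u \<in> H1 \<Omega>" "v \<in> H1 \<Omega>" "w \<in> H1 \<Omega>"
  shows "residual \<Omega> C \<kappa> u (\<lambda>x. v x + t *\<^sub>R w x) = residual \<Omega> C \<kappa> u v + t * residual \<Omega> C \<kappa> u w"
  unfolding residual_def
  by (simp add: a_form_add_scaleR[OF assms] l2_inner_add_scaleR H1_square_integrable assms algebra_simps)

lemma residual_sum:
  assumes "spd_tensor C" "u \<in> H1 \<Omega>" "finite N" "\<And>z. z \<in> N \<Longrightarrow> v z \<in> H1 \<Omega>"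
  shows "residual \<Omega> C \<kappa> u (\<lambda>x. \<Sum>z\<in>N. v z x) = (\<Sum>z\<in>N. residual \<Omega> C \<kappa> u (v z))"
  unfolding residual_def
  by (simp add: a_form_sum assms l2_inner_sum H1_square_integrable sum_subtractf sum_distrib_left)

text \<open>Bridges the gap that the partition of unity holds on the domain only, while fields are
  functions on the whole plane.\<close>

lemma residual_cong:
  assumes eq: "\<And>x. x \<in> \<Omega> \<Longrightarrow> v x = w x" and v: "v \<in> H1 \<Omega>"
  shows "residual \<Omega> C \<kappa> u w = residual \<Omega> C \<kappa> u v"
proof -
  have "strain \<Omega> w = strain \<Omega> v"
    using H1_cong[OF eq v] by (simp add: strain_def fun_eq_iff)
  moreover have "l2_inner \<Omega> u w = l2_inner \<Omega> u v"
    unfolding l2_inner_def by (rule Bochner_Integration.integral_cong) (auto simp: eq)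
  ultimately show ?thesis by (simp add: residual_def a_form_def)
qed

text \<open>The integrand vanishes where \<open>\<phi>\<close> does, so the patch can be replaced by
  the whole domain. Norms for different nodes then live on a common set and can be added.\<close>

lemma weighted_strain_norm_square:
  assumes S: "spd_tensor S" and v: "v \<in> H1 \<Omega>"
    and \<phi>: "\<phi> \<in> borel_measurable (lebesgue_on \<Omega>)" "\<And>x. x \<in> \<Omega> \<Longrightarrow> 0 \<le> \<phi> x"
  shows "(weighted_strain_norm \<Omega> S \<phi> v)\<^sup>2 = (\<integral>x. \<phi> x * (norm (S (strain \<Omega> v x)))\<^sup>2 \<partial>lebesgue_on \<Omega>)"
proof -
  let ?A = "{x\<in>\<Omega>. \<phi> x \<noteq> 0}"
  have \<Omega>: "\<Omega> \<in> sets lebesgue" using lmeasurable_\<Omega> by blast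
  have "{x \<in> space (lebesgue_on \<Omega>). \<phi> x \<noteq> 0} \<in> sets (lebesgue_on \<Omega>)"
    using \<phi>(1) by measurable
  then have A: "?A \<in> sets lebesgue"
    using \<Omega> by (auto simp: sets_restrict_space)
  have "(weighted_strain_norm \<Omega> S \<phi> v)\<^sup>2
      = (\<integral>x. (norm (sqrt (\<phi> x) *\<^sub>R S (strain \<Omega> v x)))\<^sup>2 \<partial>lebesgue_on ?A)"
    by (simp add: weighted_strain_norm_def l2_norm_square)
  also have "\<dots> = (\<integral>x. indicator ?A x *\<^sub>R (norm (sqrt (\<phi> x) *\<^sub>R S (strain \<Omega> v x)))\<^sup>2 \<partial>lebesgue)"
    using A by (intro integral_restrict_space) simp
  also have "\<dots> = (\<integral>x. indicator \<Omega> x *\<^sub>R (\<phi> x * (norm (S (strain \<Omega> v x)))\<^sup>2) \<partial>lebesgue)"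
    by (intro Bochner_Integration.integral_cong)
       (auto simp: indicator_def power_mult_distrib \<phi>(2))
  also have "\<dots> = (\<integral>x. \<phi> x * (norm (S (strain \<Omega> v x)))\<^sup>2 \<partial>lebesgue_on \<Omega>)"
    using \<Omega> by (intro integral_restrict_space[symmetric]) simp
  finally show ?thesis .
qed

text \<open>At almost every point either \<open>\<phi>\<close> or the \<open>S\<close>-image of the
  strain of \<open>w\<close> is 0, so adding \<open>t *\<^sub>R w\<close> leaves the weighted
  integrand unchanged.\<close>

lemma weighted_strain_norm_add_null:
  assumes S: "spd_tensor S" and v: "v \<in> H1 \<Omega>" and w: "w \<in> H1 \<Omega>"
    and \<phi>: "\<phi> \<in> borel_measurable (lebesgue_on \<Omega>)" "\<And>x. x \<in> \<Omega> \<Longrightarrow> 0 \<le> \<phi> x" "\<And>x. x \<in> \<Omega> \<Longrightarrow> \<phi> x \<le> 1"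
    and 0: "weighted_strain_norm \<Omega> S \<phi> w = 0"
  shows "weighted_strain_norm \<Omega> S \<phi> (\<lambda>x. v x + t *\<^sub>R w x) = weighted_strain_norm \<Omega> S \<phi> v"
proof -
  have lin: "linear S" using S unfolding spd_tensor_def by blast
  note vw = H1_add_scaleR[OF v w, of t]
  have sq: "integrable (lebesgue_on \<Omega>) (\<lambda>x. (norm (S (strain \<Omega> u x)))\<^sup>2 * \<phi> x)" if "u \<in> H1 \<Omega>" for u
    using square_integrable_tensor_strain[OF S that] \<phi>
    by (intro integrable_mult_bounded[of _ _ _ 1]) (auto simp: square_integrable_def)
  have "AE x in lebesgue_on \<Omega>. \<phi> x * (norm (S (strain \<Omega> w x)))\<^sup>2 = 0"
  proof (subst integral_nonneg_eq_0_iff_AE[symmetric])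
    show "integrable (lebesgue_on \<Omega>) (\<lambda>x. \<phi> x * (norm (S (strain \<Omega> w x)))\<^sup>2)"
      using sq[OF w] by (simp add: mult.commute)
    show "AE x in lebesgue_on \<Omega>. 0 \<le> \<phi> x * (norm (S (strain \<Omega> w x)))\<^sup>2"
      by (intro AE_I2) (simp add: \<phi>)
    show "(\<integral>x. \<phi> x * (norm (S (strain \<Omega> w x)))\<^sup>2 \<partial>lebesgue_on \<Omega>) = 0"
      using weighted_strain_norm_square[OF S w \<phi>(1,2)] 0 by simp
  qed
  then have "AE x in lebesgue_on \<Omega>. \<phi> x * (norm (S (strain \<Omega> (\<lambda>x. v x + t *\<^sub>R w x) x)))\<^sup>2
      = \<phi> x * (norm (S (strain \<Omega> v x)))\<^sup>2"
    using strain_add_scaleR[OF v w, of t]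
    by eventually_elim (auto simp: linear_add[OF lin] linear_scale[OF lin])
  then have "(weighted_strain_norm \<Omega> S \<phi> (\<lambda>x. v x + t *\<^sub>R w x))\<^sup>2 = (weighted_strain_norm \<Omega> S \<phi> v)\<^sup>2"
    using borel_measurable_integrable[OF sq[OF vw]] borel_measurable_integrable[OF sq[OF v]]
    by (subst (1 2) weighted_strain_norm_square)
       (auto intro!: integral_cong_AE S vw v \<phi>(1,2) simp: mult.commute[of "\<phi> _"])
  then show ?thesis
    by (simp add: weighted_strain_norm_def l2_norm_nonneg)
qed

end

subsection \<open>The estimator\<close>

text \<open>Both infinite values of \<open>s\<close> fall under the first alternative, as their
  squares are infinite; minus infinity is the supremum of the empty set. For finite \<open>s\<close>
  the case \<open>N e = 0\<close> is settled by \<open>shift\<close>: residuals unbounded at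
  constant norm would contradict finiteness.\<close>

lemma SUP_quotient_bound:
  fixes R N :: "'v \<Rightarrow> real"
  assumes "e \<in> V" and N: "\<And>v. 0 \<le> N v"
    and shift: "\<And>v t. v \<in> V \<Longrightarrow> N e = 0 \<Longrightarrow> \<exists>w\<in>V. N w = N v \<and> R w = R v + t * R e"
    and s: "s = (SUP v\<in>{v\<in>V. N v \<noteq> 0}. ereal (R v / N v))"
  shows "s\<^sup>2 = \<infinity> \<or> (\<exists>m. s = ereal m \<and> R e \<le> m * N e)"
proof (cases s)
  case (real m)
  have le: "R v / N v \<le> m" if "v \<in> V" "N v \<noteq> 0" for v
  proof -
    have "ereal (R v / N v) \<le> s" unfolding s by (rule SUP_upper) (use that in auto)
    then show ?thesis using real by simp
  qed
  have "R e \<le> m * N e"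
  proof (cases "N e = 0")
    case False
    then show ?thesis using le[OF assms(1)] N[of e] by (simp add: pos_divide_le_eq)
  next
    case True
    have "{v\<in>V. N v \<noteq> 0} \<noteq> {}"
    proof
      assume "{v\<in>V. N v \<noteq> 0} = {}"
      then have "s = - \<infinity>" unfolding s by (simp only:) (simp add: bot_ereal_def)
      then show False using real by simp
    qed
    then obtain v where v: "v \<in> V" "N v \<noteq> 0" by blast
    then have Nv: "N v > 0" using N[of v] by linarith
    have "R e \<le> 0"
    proof (rule ccontr)
      assume "\<not> R e \<le> 0"
      then have Re: "R e > 0" by simp
      \<comment> \<open>The multiple of \<open>e\<close> is chosen so that \<open>R w\<close> is
        \<open>m * N v + 1\<close>, just above what the supremum \<open>m\<close> allows.\<close>
      obtain w where w: "w \<in> V" "N w = N v" "R w = R v + ((m * N v - R v + 1) / R e) * R e"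
        using shift[OF v(1) True] by blast
      then have "R w = m * N v + 1" using Re by simp
      moreover have "R w \<le> m * N v"
        using le[OF w(1)] w(2) Nv by (simp add: pos_divide_le_eq)
      ultimately show False by simp
    qed
    then show ?thesis using True by simp
  qed
  then show ?thesis using real by blast
qed (simp_all add: power2_eq_square)

text \<open>One infinite square makes the estimator infinite. Otherwise the real suprema, which may
  have any sign, enter the Cauchy-Schwarz inequality.\<close>

lemma estimator_bound:
  fixes s :: "'z \<Rightarrow> ereal" and R N :: "'z \<Rightarrow> real"
  assumes "finite Z" and s: "\<And>z. z \<in> Z \<Longrightarrow> (s z)\<^sup>2 = \<infinity> \<or> (\<exists>m. s z = ereal m \<and> R z \<le> m * N z)"
  shows "sqrt_ereal (\<Sum>z\<in>Z. (s z)\<^sup>2) = \<infinity> \<or>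
    (\<exists>\<mu>\<ge>0. sqrt_ereal (\<Sum>z\<in>Z. (s z)\<^sup>2) = ereal \<mu> \<and> (\<Sum>z\<in>Z. R z) \<le> \<mu> * sqrt (\<Sum>z\<in>Z. (N z)\<^sup>2))"
proof (cases "\<exists>z\<in>Z. (s z)\<^sup>2 = \<infinity>")
  case True
  then have "(\<Sum>z\<in>Z. (s z)\<^sup>2) = \<infinity>" using assms(1) sum_Pinfty by blast
  then show ?thesis by (simp add: sqrt_ereal_def)
next
  case False
  then have "\<forall>z\<in>Z. \<exists>m. s z = ereal m \<and> R z \<le> m * N z" using s by blast
  then obtain m where m: "\<And>z. z \<in> Z \<Longrightarrow> s z = ereal (m z)" "\<And>z. z \<in> Z \<Longrightarrow> R z \<le> m z * N z"
    by metis
  have "(\<Sum>z\<in>Z. (s z)\<^sup>2) = (\<Sum>z\<in>Z. ereal ((m z)\<^sup>2))"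
    by (rule sum.cong) (auto simp: m(1))
  also have "\<dots> = ereal (\<Sum>z\<in>Z. (m z)\<^sup>2)" by (rule sum_ereal)
  finally have "sqrt_ereal (\<Sum>z\<in>Z. (s z)\<^sup>2) = ereal (sqrt (\<Sum>z\<in>Z. (m z)\<^sup>2))"
    by (simp add: sqrt_ereal_def)
  moreover have "(\<Sum>z\<in>Z. R z) \<le> sqrt (\<Sum>z\<in>Z. (m z)\<^sup>2) * sqrt (\<Sum>z\<in>Z. (N z)\<^sup>2)"
  proof -
    have "(\<Sum>z\<in>Z. R z) \<le> (\<Sum>z\<in>Z. m z * N z)" by (intro sum_mono m(2))
    also have "\<dots> \<le> sqrt ((\<Sum>z\<in>Z. (m z)\<^sup>2) * (\<Sum>z\<in>Z. (N z)\<^sup>2))"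
      by (intro real_le_rsqrt Cauchy_Schwarz_ineq_sum)
    finally show ?thesis by (simp add: real_sqrt_mult)
  qed
  ultimately show ?thesis by (intro disjI2 exI[of _ "sqrt (\<Sum>z\<in>Z. (m z)\<^sup>2)"]) (simp add: sum_nonneg)
qed

text \<open>By \<open>E\<^sup>2 = \<kappa> * d\<^sup>2 + (\<kappa>h - \<kappa>)\<close>, the \<open>L\<^sup>2\<close> error \<open>d\<close> is at most \<open>E / sqrt \<kappa>\<close>; \<open>s\<close> stands for the
  inner product of the two eigenfunctions.\<close>

lemma error_bound_algebra:
  fixes \<kappa> \<kappa>h s E d \<mu> :: real
  assumes "0 < \<kappa>" "\<kappa> \<le> \<kappa>h" "0 \<le> E" "0 \<le> d" "0 \<le> \<mu>"
    and E: "E\<^sup>2 = \<kappa> - 2 * \<kappa> * s + \<kappa>h" and d: "d\<^sup>2 = 2 - 2 * s"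
    and res: "\<kappa>h * s - \<kappa> * s \<le> \<mu> * E"
  shows "E \<le> sqrt 3 * \<mu> + (\<kappa> + \<kappa>h) / (2 * sqrt \<kappa>) * d"
proof -
  have pos: "0 \<le> (\<kappa> + \<kappa>h) / (2 * sqrt \<kappa>) * d" using assms by simp
  have "1 \<le> sqrt (3::real)" by simp
  \<comment> \<open>The bound is proved with the factor 1 and then enlarged.\<close>
  then have \<mu>3: "\<mu> \<le> sqrt 3 * \<mu>" using assms(5) mult_right_mono[of 1 "sqrt 3" \<mu>] by simp
  show ?thesis
  proof (cases "E = 0")
    case True
    then show ?thesis using pos \<mu>3 assms(5) by linarith
  next
    case False
    then have E0: "E > 0" using assms(3) by simp
    have "E\<^sup>2 = \<kappa> * d\<^sup>2 + (\<kappa>h - \<kappa>)" unfolding E d by (simp add: algebra_simps)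
    then have "(sqrt \<kappa> * d)\<^sup>2 \<le> E\<^sup>2" using assms(1,2) by (simp add: power_mult_distrib)
    then have dE: "sqrt \<kappa> * d \<le> E" using assms(3) by (rule power2_le_imp_le)
    \<comment> \<open>The first summand is the residual of the error. The second is what is left of
      the energy, since \<open>1 - s\<close> is half of \<open>d\<^sup>2\<close>.\<close>
    have "E * E = (\<kappa>h * s - \<kappa> * s) + (\<kappa> + \<kappa>h) / 2 * d\<^sup>2"
      unfolding power2_eq_square[symmetric] E d by (simp add: field_simps)
    \<comment> \<open>One factor \<open>d\<close> is kept for the claim; the other, scaled by
      \<open>sqrt \<kappa>\<close>, is traded for \<open>E\<close>, which can then be
      cancelled.\<close>
    also have "(\<kappa> + \<kappa>h) / 2 * d\<^sup>2 = (\<kappa> + \<kappa>h) / (2 * sqrt \<kappa>) * d * (sqrt \<kappa> * d)"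
      using assms(1) by (simp add: power2_eq_square)
    also have "(\<kappa>h * s - \<kappa> * s) + \<dots> \<le> \<mu> * E + (\<kappa> + \<kappa>h) / (2 * sqrt \<kappa>) * d * E"
      by (intro add_mono res mult_left_mono dE pos)
    also have "\<dots> = (\<mu> + (\<kappa> + \<kappa>h) / (2 * sqrt \<kappa>) * d) * E" by (simp add: distrib_right)
    finally have "E \<le> \<mu> + (\<kappa> + \<kappa>h) / (2 * sqrt \<kappa>) * d" using E0 by (rule mult_right_le_imp_le)
    then show ?thesis using \<mu>3 by linarith
  qed
qed

theorem theorem3p10:
  fixes \<Omega> \<Gamma>D \<Gamma>g :: "(real^2) set"
    and \<T> :: "(real^2) set set"
    and C S :: tensor
    and c_reg c_qu :: real
    and \<phi> :: "real^2 \<Rightarrow> real^2 \<Rightarrow> real"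
    and k j :: nat
    and \<kappa> \<kappa>h :: real
    and u uh e :: vfield
    and H Hh :: "vfield set"
    and \<mu> :: ereal
  assumes domain: "lipschitz_domain \<Omega>" "polygonal_boundary \<Omega>"
    and parts: "closed \<Gamma>D" "\<Gamma>D \<subseteq> frontier \<Omega>" "connected \<Gamma>D"
               "closed \<Gamma>g" "\<Gamma>g \<subseteq> frontier \<Omega>" "connected \<Gamma>g"
               "connected (frontier \<Omega> - (\<Gamma>D \<union> \<Gamma>g))"
               "\<Gamma>D \<inter> \<Gamma>g \<subseteq> nodes \<T>"
    and tensor: "spd_tensor C" "tensor_sqrt C S"
    and mesh: "triangulation_of \<T> \<Omega>" "shape_regular c_reg \<T>" "quasi_uniform c_qu \<T>"
              "resolves_boundary \<T> \<Omega> \<Gamma>D \<Gamma>g"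
    and hat: "\<And>z. z \<in> nodes \<T> \<Longrightarrow> hat_function \<T> z (\<phi> z)"
    and k: "k \<ge> 1"
    and H: "H = H_space \<Omega> \<Gamma>D \<Gamma>g"
    and Hh: "Hh = FE_space \<T> k H"
    and cont: "eigenpair \<Omega> C H \<kappa> u"
    and disc: "eigenpair \<Omega> C Hh \<kappa>h uh"
    and index: "eigenvalue_index \<Omega> C H j \<kappa>" "eigenvalue_index \<Omega> C Hh j \<kappa>h" "\<kappa> \<le> \<kappa>h"
    and simple: "simple_eigenvalue \<Omega> C H \<kappa>"
    and pos: "\<kappa> > 0"
    and e: "e = (\<lambda>x. u x - uh x)"
    and \<mu>: "\<mu> = estimator \<Omega> C S H \<kappa>h uh (nodes \<T>) \<phi>"
  shows "ereal (energy_norm \<Omega> C e)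
           \<le> ereal (sqrt 3) * \<mu> + ereal ((\<kappa> + \<kappa>h) / (2 * sqrt \<kappa>) * l2_norm \<Omega> e)"
proof -
  interpret bounded_open_set \<Omega>
    using domain(1) unfolding lipschitz_domain_def bounded_open_set_def by blast
  have C: "spd_tensor C" by (rule tensor(1))
  have S: "spd_tensor S" using tensor(2) unfolding tensor_sqrt_def by blast
  note \<T> = triangulation_of_cover[OF mesh(1)]
  note hat01 = hat_function_bounds[OF mesh(1) hat]
  have HH1: "v \<in> H1 \<Omega>" if "v \<in> H" for v using that H H_space_subset_H1 by blast
  have u: "u \<in> H" "l2_norm \<Omega> u = 1" and au: "\<And>v. v \<in> H \<Longrightarrow> a_form \<Omega> C u v = \<kappa> * l2_inner \<Omega> u v"
    using cont unfolding eigenpair_def by blast+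
  have uh: "uh \<in> Hh" "uh \<in> H" "l2_norm \<Omega> uh = 1"
    and auh: "\<And>v. v \<in> Hh \<Longrightarrow> a_form \<Omega> C uh v = \<kappa>h * l2_inner \<Omega> uh v"
    using disc Hh unfolding eigenpair_def FE_space_def by blast+
  have e': "e = (\<lambda>x. u x + (-1) *\<^sub>R uh x)" unfolding e by simp
  have eH: "e \<in> H" unfolding e' H using u(1) uh(2) H by (intro H_space_add_scaleR) auto
  note u1 = HH1[OF u(1)] and uh1 = HH1[OF uh(2)] and e1 = HH1[OF eH]
  note fin = finite_nodes[OF mesh(1)]
  have \<phi>: "0 \<le> \<phi> z x" "\<phi> z x \<le> 1" if "z \<in> nodes \<T>" "x \<in> \<Omega>" for z x
    using hat01[OF that(1)] that(2) \<T>(3) by blast+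
  note \<phi>m = hat_function_measurable[OF mesh(1) hat]
  note \<phi>v = hat_function_mult_H1[OF mesh(1) hat]
  have \<phi>_sum: "(\<Sum>z\<in>nodes \<T>. \<phi> z x) = 1" if "x \<in> \<Omega>" for x
    using hat_functions_sum[OF mesh(1) hat] that \<T>(3) by blast
  define R where "R z v = residual \<Omega> C \<kappa>h uh (\<lambda>x. \<phi> z x *\<^sub>R v x)" for z v
  define W where "W z v = weighted_strain_norm \<Omega> S (\<phi> z) v" for z v
  have local_bound: "(local_estimator \<Omega> C S H \<kappa>h uh (\<phi> z))\<^sup>2 = \<infinity> \<or>
      (\<exists>m. local_estimator \<Omega> C S H \<kappa>h uh (\<phi> z) = ereal m \<and> R z e \<le> m * W z e)"
    if z: "z \<in> nodes \<T>" for z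
  proof (rule SUP_quotient_bound[OF eH])
    show "0 \<le> W z v" for v by (simp add: W_def weighted_strain_norm_def l2_norm_nonneg)
    show "local_estimator \<Omega> C S H \<kappa>h uh (\<phi> z) = (SUP v\<in>{v \<in> H. W z v \<noteq> 0}. ereal (R z v / W z v))"
      by (simp add: local_estimator_def R_def W_def)
    \<comment> \<open>Adding \<open>t *\<^sub>R e\<close> to \<open>v\<close> moves the local
      residual by \<open>t * R z e\<close> at unchanged weighted norm.\<close>
    fix v t assume v: "v \<in> H" and "W z e = 0"
    note v1 = HH1[OF v]
    show "\<exists>w\<in>H. W z w = W z v \<and> R z w = R z v + t * R z e"
    proof (intro bexI conjI)
      show "(\<lambda>x. v x + t *\<^sub>R e x) \<in> H" unfolding H using v eH H by (intro H_space_add_scaleR) auto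
      show "W z (\<lambda>x. v x + t *\<^sub>R e x) = W z v"
        using \<open>W z e = 0\<close> unfolding W_def
        by (intro weighted_strain_norm_add_null S v1 e1 \<phi>m[OF z] \<phi>[OF z])
      have "(\<lambda>x. \<phi> z x *\<^sub>R (v x + t *\<^sub>R e x)) = (\<lambda>x. \<phi> z x *\<^sub>R v x + t *\<^sub>R (\<phi> z x *\<^sub>R e x))"
        by (simp add: scaleR_add_right mult.commute)
      then show "R z (\<lambda>x. v x + t *\<^sub>R e x) = R z v + t * R z e"
        unfolding R_def
        by (simp only: residual_add_scaleR[OF C uh1 \<phi>v[OF z v1] \<phi>v[OF z e1]])
    qed
  qed
  have sum_R: "(\<Sum>z\<in>nodes \<T>. R z e) = residual \<Omega> C \<kappa>h uh e"
  proof -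
    have "residual \<Omega> C \<kappa>h uh (\<lambda>x. \<Sum>z\<in>nodes \<T>. \<phi> z x *\<^sub>R e x) = (\<Sum>z\<in>nodes \<T>. R z e)"
      unfolding R_def by (intro residual_sum C uh1 fin \<phi>v e1)
    moreover have "residual \<Omega> C \<kappa>h uh (\<lambda>x. \<Sum>z\<in>nodes \<T>. \<phi> z x *\<^sub>R e x) = residual \<Omega> C \<kappa>h uh e"
    proof (rule residual_cong[OF _ e1])
      show "e x = (\<Sum>z\<in>nodes \<T>. \<phi> z x *\<^sub>R e x)" if "x \<in> \<Omega>" for x
        using \<phi>_sum[OF that] by (simp flip: scaleR_left.sum)
    qed
    ultimately show ?thesis by simp
  qed
  define E where "E = energy_norm \<Omega> C e"
  have aee: "a_form \<Omega> C e e = (\<integral>x. (norm (S (strain \<Omega> e x)))\<^sup>2 \<partial>lebesgue_on \<Omega>)"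
    by (rule a_form_eq_sqrt[OF tensor(2)])
  then have "0 \<le> a_form \<Omega> C e e" by simp
  then have E: "E\<^sup>2 = a_form \<Omega> C e e" "0 \<le> E" by (auto simp: E_def energy_norm_def)
  \<comment> \<open>As the weights sum to 1 at each point of the domain, overlapping patches cost no
    constant.\<close>
  have sum_W: "(\<Sum>z\<in>nodes \<T>. (W z e)\<^sup>2) = E\<^sup>2"
  proof -
    let ?s = "\<lambda>x. (norm (S (strain \<Omega> e x)))\<^sup>2"
    have int: "integrable (lebesgue_on \<Omega>) (\<lambda>x. ?s x * \<phi> z x)" if "z \<in> nodes \<T>" for z
      using square_integrable_tensor_strain[OF S e1] \<phi>[OF that] \<phi>m[OF that]
      by (intro integrable_mult_bounded[of _ _ _ 1]) (auto simp: square_integrable_def)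
    have "(\<Sum>z\<in>nodes \<T>. (W z e)\<^sup>2) = (\<Sum>z\<in>nodes \<T>. \<integral>x. ?s x * \<phi> z x \<partial>lebesgue_on \<Omega>)"
      unfolding W_def
    proof (rule sum.cong[OF refl])
      fix z assume z: "z \<in> nodes \<T>"
      show "(weighted_strain_norm \<Omega> S (\<phi> z) e)\<^sup>2 = (\<integral>x. ?s x * \<phi> z x \<partial>lebesgue_on \<Omega>)"
        by (subst weighted_strain_norm_square[OF S e1 \<phi>m[OF z] \<phi>(1)[OF z]]) (auto simp: mult.commute)
    qed
    also have "\<dots> = (\<integral>x. (\<Sum>z\<in>nodes \<T>. ?s x * \<phi> z x) \<partial>lebesgue_on \<Omega>)"
      by (intro Bochner_Integration.integral_sum[symmetric] int)
    also have "\<dots> = (\<integral>x. ?s x \<partial>lebesgue_on \<Omega>)"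
    proof (rule Bochner_Integration.integral_cong[OF refl])
      show "(\<Sum>z\<in>nodes \<T>. ?s x * \<phi> z x) = ?s x" if "x \<in> space (lebesgue_on \<Omega>)" for x
        using \<phi>_sum[of x] that by (simp flip: sum_distrib_left)
    qed
    finally show ?thesis using aee E by simp
  qed
  have est: "\<mu> = \<infinity> \<or> (\<exists>m\<ge>0. \<mu> = ereal m \<and> residual \<Omega> C \<kappa>h uh e \<le> m * E)"
    using estimator_bound[of "nodes \<T>" "\<lambda>z. local_estimator \<Omega> C S H \<kappa>h uh (\<phi> z)"
        "\<lambda>z. R z e" "\<lambda>z. W z e", OF fin local_bound] E(2)
    unfolding \<mu> estimator_def sum_R sum_W by simp
  define s where "s = l2_inner \<Omega> u uh"
  note su = H1_square_integrable[OF u1] and suh = H1_square_integrable[OF uh1] and se = H1_square_integrable[OF e1]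
  have s': "l2_inner \<Omega> uh u = s" by (simp add: s_def l2_inner_commute)
  have uu: "l2_inner \<Omega> u u = 1" "l2_inner \<Omega> uh uh = 1" using u uh by (simp_all add: l2_inner_self)
  have inner_diff: "l2_inner \<Omega> w e = l2_inner \<Omega> w u - l2_inner \<Omega> w uh" if "square_integrable \<Omega> w" for w
    unfolding e' using l2_inner_add_scaleR[OF that su suh, of "-1"] by linarith
  have inner_e: "l2_inner \<Omega> u e = 1 - s" "l2_inner \<Omega> uh e = s - 1"
    using inner_diff[OF su] inner_diff[OF suh] uu s' by (simp_all add: s_def)
  have d: "(l2_norm \<Omega> e)\<^sup>2 = 2 - 2 * s"
    using inner_diff[OF se] inner_e l2_inner_commute[of \<Omega> e u] l2_inner_commute[of \<Omega> e uh]
      l2_inner_self[of \<Omega> e] by linarith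
  \<comment> \<open>The first three values come from the continuous equation, tested with
    \<open>u\<close> and with \<open>uh\<close>, which lies in \<open>H\<close>, and from the
    symmetry of \<open>a_form\<close>; the last is the discrete equation tested with
    \<open>uh\<close>.\<close>
  have a_uu: "a_form \<Omega> C u u = \<kappa>" "a_form \<Omega> C u uh = \<kappa> * s" "a_form \<Omega> C uh u = \<kappa> * s"
    "a_form \<Omega> C uh uh = \<kappa>h"
    using au[OF u(1)] au[OF uh(2)] auh[OF uh(1)] a_form_commute[OF C, of \<Omega> uh u] uu by (simp_all add: s_def)
  have a_diff: "a_form \<Omega> C w e = a_form \<Omega> C w u - a_form \<Omega> C w uh" if "w \<in> H1 \<Omega>" for w
    unfolding e' using a_form_add_scaleR[OF C that u1 uh1, of "-1"] by linarith
  have a_e: "a_form \<Omega> C u e = \<kappa> - \<kappa> * s" "a_form \<Omega> C uh e = \<kappa> * s - \<kappa>h"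
    using a_diff[OF u1] a_diff[OF uh1] a_uu by simp_all
  have E2: "E\<^sup>2 = \<kappa> - 2 * \<kappa> * s + \<kappa>h"
    using a_diff[OF e1] a_e a_form_commute[OF C, of \<Omega> e u] a_form_commute[OF C, of \<Omega> e uh] E(1) by linarith
  have res: "residual \<Omega> C \<kappa>h uh e = \<kappa>h * s - \<kappa> * s"
    unfolding residual_def by (simp add: inner_e a_e algebra_simps)
  from est show ?thesis
  proof
    assume "\<mu> = \<infinity>"
    then show ?thesis by simp
  next
    assume "\<exists>m\<ge>0. \<mu> = ereal m \<and> residual \<Omega> C \<kappa>h uh e \<le> m * E"
    then obtain m where m: "0 \<le> m" "\<mu> = ereal m" "residual \<Omega> C \<kappa>h uh e \<le> m * E" by blast
    have "E \<le> sqrt 3 * m + (\<kappa> + \<kappa>h) / (2 * sqrt \<kappa>) * l2_norm \<Omega> e"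
      using m(3) unfolding res
      by (rule error_bound_algebra[OF pos index(3) E(2) l2_norm_nonneg m(1) E2 d])
    then show ?thesis by (simp add: m(2) flip: E_def)
  qed
qed

end
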